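(* Let $n,m\ge1$ and let $(A,B)\in\mathbb R^{n\times n}\times(\mathbb R^{n\times m}\setminus\{0\})$. With $\mathcal R$, $\mathcal D_{bbp}$, $(\mathcal{TP})^{M,y_0}$ and $(\mathcal{NP})^{T,y_0}$ as defined in the context, the following hold: (P1) If $(M,y_0)\in\mathcal D_{bbp}$, then $(\mathcal{TP})^{M,y_0}$ has the bang-bang property; if $(M,y_0)\in\big((0,\infty)\times(\mathbb R^n\setminus\{0\})\big)\setminus\mathcal D_{bbp}$, then $(\mathcal{TP})^{M,y_0}$ has no admissible control. (P2) If $(T,y_0)\in(0,\infty)\times(\mathcal R\setminus\{0\})$, then $(\mathcal{NP})^{T,y_0}$ has the bang-bang property; if $(T,y_0)\in(0,\infty)\times(\mathbb R^n\setminus\mathcal R)$, then $(\mathcal{NP})^{T,y_0}$ has no admissible control.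
   Context: For $y_0\in\mathbb R^n$ and $u\in L^\infty(\mathbb R^+;\mathbb R^m)$ ($\mathbb R^+=[0,\infty)$), $y(\cdot;y_0,u)$ solves $y'(t)=Ay(t)+Bu(t)$, $t>0$, $y(0)=y_0$. For $T\in(0,\infty)$ and $v\in L^\infty(0,T;\mathbb R^m)$, $\hat y(\cdot;y_0,v)$ solves $y'(t)=Ay(t)+Bv(t)$, $0<t\le T$, $y(0)=y_0$. $\|\cdot\|_{\mathbb R^m}$ is the Euclidean norm. Minimal time problem. For $M>0$, $y_0\in\mathbb R^n\setminus\{0\}$, let $\mathbb U^M=\{u:\mathbb R^+\to\mathbb R^m\text{ measurable}:\|u\|_{L^\infty(\mathbb R^+;\mathbb R^m)}\le M\}$ and $(\mathcal{TP})^{M,y_0}$: $\mathcal T(M,y_0)=\inf\{\hat t>0:\exists u\in\mathbb U^M\text{ s.t. }y(\hat t;y_0,u)=0\}$. An admissible control is $u\in\mathbb U^M$ with $y(\hat t;y_0,u)=0$ for some $\hat t\in(0,\infty)$. A minimal time control is $u^*\in\mathbb U^M$ with $y(\mathcal T(M,y_0);y_0,u^* )=0$ and $u^*=0$ over $(\mathcal T(M,y_0),\infty)$. $(\mathcal{TP})^{M,y_0}$ has the bang-bang property if it has an admissible control and every minimal time control $u^*$ satisfies $\|u^*(t)\|_{\mathbb R^m}=M$ for a.e. $t\in(0,\mathcal T(M,y_0))$. Minimal norm problem. For $T\in(0,\infty)$, $y_0\in\mathbb R^n\setminus\{0\}$, $(\mathcal{NP})^{T,y_0}$: $\mathcal N(T,y_0)=\inf\{\|v\|_{L^\infty(0,T;\mathbb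 R^m)}:v\in L^\infty(0,T;\mathbb R^m),\ \hat y(T;y_0,v)=0\}$ ($\inf\emptyset=\infty$). An admissible control is $v\in L^\infty(0,T;\mathbb R^m)$ with $\hat y(T;y_0,v)=0$; a minimal norm control is an admissible $v^*$ with $\|v^*\|_{L^\infty(0,T;\mathbb R^m)}=\mathcal N(T,y_0)$. $(\mathcal{NP})^{T,y_0}$ has the bang-bang property if it has an admissible control and every minimal norm control $v^*$ satisfies $\|v^*(t)\|_{\mathbb R^m}=\mathcal N(T,y_0)$ for a.e. $t\in(0,T)$. $\mathcal R=\mathcal B+A\mathcal B+\cdots+A^n\mathcal B$ with $\mathcal B=\{Bx:x\in\mathbb R^m\}$, and $\mathcal D_{bbp}=\{(M,y_0)\in(0,\infty)\times(\mathcal R\setminus\{0\}):M>\lim_{T\to\infty}\mathcal N(T,y_0)\}$ (the limit exists since $\mathcal N(\cdot,y_0)$ is decreasing). *)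

theory Defs
  imports "HOL-Analysis.Analysis" "HOL-Probability.Essential_Supremum" "HOL-Library.Set_Algebras"
begin

text \<open>Controls are functions \<^typ>\<open>real \<Rightarrow> real ^ 'm\<close> of which only the values on the time set \<open>S\<close>
  matter; \<open>S\<close> is \<^term>\<open>{0::real..}\<close> or \<^term>\<open>{0::real<..<T}\<close>. They are Lebesgue measurable
  representatives of their \<open>L\<^sup>\<infinity>\<close> classes, so pointwise requirements on them are imposed
  almost everywhere.\<close>

definition Linf_norm :: "real set \<Rightarrow> (real \<Rightarrow> real ^ 'm) \<Rightarrow> ereal"
  where "Linf_norm S u = esssup (lebesgue_on S) (\<lambda>t. ereal (norm (u t)))"

definition Linf :: "real set \<Rightarrow> (real \<Rightarrow> real ^ 'm) set"
  where "Linf S = {u. u \<in> borel_measurable (lebesgue_on S) \<and> Linf_norm S u < \<infinity>}"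

text \<open>As the control is only measurable, \<open>y' = A y + B u\<close>, \<open>y 0 = y0\<close> is understood in the sense of
  Caratheodory, i.e. as the integral equation. The time interval \<open>I\<close> is \<^term>\<open>{0::real..}\<close> or
  \<^term>\<open>{0..T::real}\<close>.\<close>

definition solves ::
    "real set \<Rightarrow> real ^ 'n ^ 'n \<Rightarrow> real ^ 'm ^ 'n \<Rightarrow> real ^ 'n \<Rightarrow> (real \<Rightarrow> real ^ 'm) \<Rightarrow> (real \<Rightarrow> real ^ 'n) \<Rightarrow> bool"
  where "solves I A B y0 u y \<longleftrightarrow>
    continuous_on I y \<and>
    (\<forall>t\<in>I. integrable (lebesgue_on {0..t}) (\<lambda>s. A *v y s + B *v u s) \<and>
           y t = y0 + integral\<^sup>L (lebesgue_on {0..t}) (\<lambda>s. A *v y s + B *v u s))"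

text \<open>The solution (unique on \<open>I\<close>) with initial state \<open>y0\<close> and control \<open>u\<close> vanishes at time \<open>t\<close>.\<close>

definition vanishes_at ::
    "real set \<Rightarrow> real ^ 'n ^ 'n \<Rightarrow> real ^ 'm ^ 'n \<Rightarrow> real ^ 'n \<Rightarrow> (real \<Rightarrow> real ^ 'm) \<Rightarrow> real \<Rightarrow> bool"
  where "vanishes_at I A B y0 u t \<longleftrightarrow> (\<exists>y. solves I A B y0 u y \<and> y t = 0)"


subsection \<open>Minimal time problem\<close>

definition bounded_controls :: "real \<Rightarrow> (real \<Rightarrow> real ^ 'm) set"
  where "bounded_controls M =
    {u. u \<in> borel_measurable (lebesgue_on {0..}) \<and> Linf_norm {0..} u \<le> ereal M}"

definition min_time :: "real ^ 'n ^ 'n \<Rightarrow> real ^ 'm ^ 'n \<Rightarrow> real \<Rightarrow> real ^ 'n \<Rightarrow> ereal"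
  where "min_time A B M y0 =
    Inf {ereal t | t. 0 < t \<and> (\<exists>u\<in>bounded_controls M. vanishes_at {0..} A B y0 u t)}"

definition TP_admissible ::
    "real ^ 'n ^ 'n \<Rightarrow> real ^ 'm ^ 'n \<Rightarrow> real \<Rightarrow> real ^ 'n \<Rightarrow> (real \<Rightarrow> real ^ 'm) \<Rightarrow> bool"
  where "TP_admissible A B M y0 u \<longleftrightarrow>
    u \<in> bounded_controls M \<and> (\<exists>t>0. vanishes_at {0..} A B y0 u t)"

definition min_time_control ::
    "real ^ 'n ^ 'n \<Rightarrow> real ^ 'm ^ 'n \<Rightarrow> real \<Rightarrow> real ^ 'n \<Rightarrow> (real \<Rightarrow> real ^ 'm) \<Rightarrow> bool"
  where "min_time_control A B M y0 u \<longleftrightarrow>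
    u \<in> bounded_controls M \<and>
    (\<exists>\<tau>::real. min_time A B M y0 = ereal \<tau> \<and> vanishes_at {0..} A B y0 u \<tau> \<and>
         (AE t in lebesgue_on {\<tau><..}. u t = 0))"

definition TP_bang_bang :: "real ^ 'n ^ 'n \<Rightarrow> real ^ 'm ^ 'n \<Rightarrow> real \<Rightarrow> real ^ 'n \<Rightarrow> bool"
  where "TP_bang_bang A B M y0 \<longleftrightarrow>
    (\<exists>u. TP_admissible A B M y0 u) \<and>
    (\<forall>u. min_time_control A B M y0 u \<longrightarrow>
      (AE t in lebesgue_on {t. 0 < t \<and> ereal t < min_time A B M y0}. norm (u t) = M))"


subsection \<open>Minimal norm problem\<close>

definition NP_admissible ::
    "real ^ 'n ^ 'n \<Rightarrow> real ^ 'm ^ 'n \<Rightarrow> real \<Rightarrow> real ^ 'n \<Rightarrow> (real \<Rightarrow> real ^ 'm) \<Rightarrow> bool"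
  where "NP_admissible A B T y0 v \<longleftrightarrow> v \<in> Linf {0<..<T} \<and> vanishes_at {0..T} A B y0 v T"

definition min_norm :: "real ^ 'n ^ 'n \<Rightarrow> real ^ 'm ^ 'n \<Rightarrow> real \<Rightarrow> real ^ 'n \<Rightarrow> ereal"
  where "min_norm A B T y0 = Inf {Linf_norm {0<..<T} v | v. NP_admissible A B T y0 v}"

definition min_norm_control ::
    "real ^ 'n ^ 'n \<Rightarrow> real ^ 'm ^ 'n \<Rightarrow> real \<Rightarrow> real ^ 'n \<Rightarrow> (real \<Rightarrow> real ^ 'm) \<Rightarrow> bool"
  where "min_norm_control A B T y0 v \<longleftrightarrow>
    NP_admissible A B T y0 v \<and> Linf_norm {0<..<T} v = min_norm A B T y0"

definition NP_bang_bang :: "real ^ 'n ^ 'n \<Rightarrow> real ^ 'm ^ 'n \<Rightarrow> real \<Rightarrow> real ^ 'n \<Rightarrow> bool"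
  where "NP_bang_bang A B T y0 \<longleftrightarrow>
    (\<exists>v. NP_admissible A B T y0 v) \<and>
    (\<forall>v. min_norm_control A B T y0 v \<longrightarrow>
      (AE t in lebesgue_on {0<..<T}. ereal (norm (v t)) = min_norm A B T y0))"


subsection \<open>Controllable subspace and bang-bang region\<close>

text \<open>The sum is the Minkowski sum of sets. Powers of \<open>A\<close> are iterates of the linear map, since
  \<open>A ^ i\<close> would be the entrywise power.\<close>

definition ctrl_space :: "real ^ 'n ^ 'n \<Rightarrow> real ^ 'm ^ 'n \<Rightarrow> (real ^ 'n) set"
  where "ctrl_space A B = (\<Sum>i\<le>CARD('n). ((*v) A ^^ i) ` range ((*v) B))"

definition D_bbp :: "real ^ 'n ^ 'n \<Rightarrow> real ^ 'm ^ 'n \<Rightarrow> (real \<times> (real ^ 'n)) set"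
  where "D_bbp A B =
    {(M, y0). 0 < M \<and> y0 \<in> ctrl_space A B - {0} \<and> ereal M > Lim at_top (\<lambda>T. min_norm A B T y0)}"

end

theory Submission
  imports Defs
begin

text \<open>
  By variation of constants, the control \<open>u\<close> steers \<open>y0\<close> to zero at time \<open>T\<close> iff the moment equation
  \<open>y0 + (\<integral>\<^sub>0\<^sup>T exp (- s A) B u(s) ds) = 0\<close> holds. The integral always lies in \<open>\<R>\<close>, and controls supported
  on any non-null set \<open>S\<close> already attain every vector of \<open>\<R>\<close>: if \<open>p\<close> is orthogonal to all attained
  vectors, then \<open>p\<^sup>T exp (- s A) B\<close> vanishes for almost every \<open>s \<in> S\<close>, hence so do all its derivatives, and
  \<open>p\<close> is orthogonal to \<open>\<R>\<close>.

  Thus, if a control bounded by \<open>M > 0\<close> stays below \<open>M - \<epsilon>\<close> on a non-null set, shrinking it slightly and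
  compensating with a control supported on that set gives a control with a bound strictly below \<open>M\<close>. This
  is the bang-bang property of the minimal norm problem. For the minimal time problem, a control with
  bound \<open>M' < M\<close> has room for correcting the small error that is made by stopping it slightly earlier.
\<close>

section \<open>Matrix exponential\<close>

lemma bounded_bilinear_matrix_matrix_mult:
  "bounded_bilinear ((**) :: real^'k^'n \<Rightarrow> real^'m^'k \<Rightarrow> real^'m^'n)"
  unfolding bilinear_conv_bounded_bilinear[symmetric] bilinear_def
  by (auto intro!: linearI simp: vec_eq_iff matrix_matrix_mult_def sum.distrib sum_distrib_left algebra_simps)

lemma bounded_bilinear_matrix_vector_mult:
  "bounded_bilinear ((*v) :: real^'m^'n \<Rightarrow> real^'m \<Rightarrow> real^'n)"
  unfolding bilinear_conv_bounded_bilinear[symmetric] bilinear_def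
  by (auto intro!: linearI simp: vec_eq_iff matrix_vector_mult_def sum.distrib sum_distrib_left algebra_simps)

definition mpow :: "real^'n^'n \<Rightarrow> nat \<Rightarrow> real^'n^'n"
  where "mpow A k = (((**) A) ^^ k) (mat 1)"

definition mexp :: "real^'n^'n \<Rightarrow> real \<Rightarrow> real^'n^'n"
  where "mexp A s = (\<Sum>k. (s ^ k / fact k) *\<^sub>R mpow A k)"

lemma mpow_0 [simp]: "mpow A 0 = mat 1"
  by (simp add: mpow_def)

lemma mpow_Suc: "mpow A (Suc k) = A ** mpow A k"
  by (simp add: mpow_def)

lemma mpow_commute: "mpow A k ** A = A ** mpow A k"
  by (induction k) (simp_all add: mpow_Suc matrix_mul_assoc[symmetric])

lemma mpow_vector: "mpow A k *v x = (((*v) A) ^^ k) x"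
  by (induction k) (simp_all add: mpow_Suc matrix_vector_mul_assoc[symmetric])

text \<open>Only the constant \<open>K\<close> of the bounded bilinear matrix product is used, hence
  the rate \<open>norm A * K\<close>. It permits comparison with the scalar exponential
  series.\<close>

lemma norm_mpow_le:
  fixes A :: "real^'n^'n"
  shows "\<exists>c\<ge>0. \<forall>k. norm (mpow A k) \<le> c ^ k * norm (mat 1 :: real^'n^'n)"
proof -
  obtain K where K: "\<And>(X::real^'n^'n) (Y::real^'n^'n). norm (X ** Y) \<le> norm X * norm Y * K" "K \<ge> 0"
    using bounded_bilinear.nonneg_bounded[OF bounded_bilinear_matrix_matrix_mult] by blast
  have "norm (mpow A k) \<le> (norm A * K) ^ k * norm (mat 1 :: real^'n^'n)" for k :: nat
  proof (induction k)
    case (Suc k)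
    have "norm (mpow A (Suc k)) \<le> (norm A * K) * norm (mpow A k)"
      using K(1)[of A "mpow A k"] by (simp add: mpow_Suc mult_ac)
    also have "\<dots> \<le> (norm A * K) * ((norm A * K) ^ k * norm (mat 1 :: real^'n^'n))"
      by (intro mult_left_mono Suc) (use K in auto)
    finally show ?case by (simp add: mult_ac)
  qed auto
  then show ?thesis using K(2) by (intro exI[of _ "norm A * K"]) auto
qed

lemma summable_mexp: "summable (\<lambda>k. (s ^ k / fact k) *\<^sub>R mpow A k)"
  for A :: "real^'n^'n"
proof -
  obtain c where c: "c \<ge> 0" "\<And>k. norm (mpow A k) \<le> c ^ k * norm (mat 1 :: real^'n^'n)"
    using norm_mpow_le by blast
  have "summable (\<lambda>k. norm (mat 1 :: real^'n^'n) * (inverse (fact k) * (\<bar>s\<bar> * c) ^ k))"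
    by (intro summable_mult summable_exp)
  then show ?thesis
  proof (rule summable_comparison_test'[where N = 0])
    fix k
    show "norm ((s ^ k / fact k) *\<^sub>R mpow A k)
      \<le> norm (mat 1 :: real^'n^'n) * (inverse (fact k) * (\<bar>s\<bar> * c) ^ k)"
      using mult_left_mono[OF c(2)[of k], of "\<bar>s\<bar> ^ k / fact k"]
      by (simp add: power_mult_distrib power_abs field_simps)
  qed
qed

lemma mexp_sums: "(\<lambda>k. (s ^ k / fact k) *\<^sub>R mpow A k) sums mexp A s"
  unfolding mexp_def using summable_mexp by (rule summable_sums)

lemma mexp_0 [simp]: "mexp A 0 = mat 1"
proof -
  have "(\<lambda>k. (0 ^ k / fact k) *\<^sub>R mpow A k) sums (\<Sum>k\<in>{0}. (0 ^ k / fact k) *\<^sub>R mpow A k)"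
    by (rule sums_finite) auto
  with mexp_sums[of 0 A] show ?thesis
    by (simp add: sums_unique2)
qed

lemma mexp_commute: "mexp A s ** A = A ** mexp A s"
proof -
  have "(\<lambda>k. (s ^ k / fact k) *\<^sub>R mpow A k ** A) sums (mexp A s ** A)"
    by (rule bounded_linear.sums[OF bounded_bilinear.bounded_linear_left[OF bounded_bilinear_matrix_matrix_mult] mexp_sums])
  moreover have "(\<lambda>k. A ** ((s ^ k / fact k) *\<^sub>R mpow A k)) sums (A ** mexp A s)"
    by (rule bounded_linear.sums[OF bounded_bilinear.bounded_linear_right[OF bounded_bilinear_matrix_matrix_mult] mexp_sums])
  moreover have "(s ^ k / fact k) *\<^sub>R mpow A k ** A = A ** ((s ^ k / fact k) *\<^sub>R mpow A k)" for k
    by (simp add: bounded_bilinear.scaleR_left[OF bounded_bilinear_matrix_matrix_mult]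
        bounded_bilinear.scaleR_right[OF bounded_bilinear_matrix_matrix_mult] mpow_commute)
  ultimately show ?thesis
    by (simp add: sums_unique2)
qed

lemma mexp_component_sums: "(\<lambda>k. (mpow A k $ i $ j / fact k) * s ^ k) sums (mexp A s $ i $ j)"
  for A :: "real^'n^'n"
proof -
  have "bounded_linear (\<lambda>X::real^'n^'n. X $ i $ j)"
    by (intro bounded_linear_compose[OF bounded_linear_vec_nth] bounded_linear_vec_nth)
  from bounded_linear.sums[OF this mexp_sums[of s A]] show ?thesis
    by (simp add: mult_ac)
qed

text \<open>Each entry is a scalar power series converging everywhere and may be differentiated term
  by term.\<close>

lemma mexp_has_vector_derivative:
  "(mexp A has_vector_derivative A ** mexp A s) (at s within S)"
proof -
  have "((\<lambda>s. mexp A s $ i $ j) has_field_derivative (A ** mexp A s) $ i $ j) (at s)" for i j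
  proof -
    let ?c = "\<lambda>k. mpow A k $ i $ j / fact k"
    have "((\<lambda>s. \<Sum>k. ?c k * s ^ k) has_field_derivative (\<Sum>k. diffs ?c k * s ^ k)) (at s)"
      by (rule termdiffs_strong_converges_everywhere) (use mexp_component_sums in \<open>auto simp: sums_iff\<close>)
    moreover have "(\<lambda>k. diffs ?c k * s ^ k) sums ((A ** mexp A s) $ i $ j)"
    proof -
      \<comment> \<open>\<open>diffs\<close> shifts the index by one, and the factor
        \<open>Suc k\<close> cancels against the factorial.\<close>
      have "diffs ?c k = (A ** mpow A k) $ i $ j / fact k" for k
        by (simp add: diffs_def mpow_Suc del: of_nat_Suc)
      then have "diffs ?c k * s ^ k = (\<Sum>l\<in>UNIV. A $ i $ l * ((mpow A k $ l $ j / fact k) * s ^ k))" for k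
        by (simp add: matrix_matrix_mult_def sum_distrib_left sum_distrib_right sum_divide_distrib mult_ac)
      moreover have "(\<lambda>k. \<Sum>l\<in>UNIV. A $ i $ l * ((mpow A k $ l $ j / fact k) * s ^ k)) sums
          (\<Sum>l\<in>UNIV. A $ i $ l * mexp A s $ l $ j)"
        by (intro sums_sum sums_mult mexp_component_sums)
      ultimately show ?thesis
        by (simp only: matrix_matrix_mult_def vec_lambda_beta)
    qed
    moreover have "mexp A s $ i $ j = (\<Sum>k. ?c k * s ^ k)" for s
      by (rule sums_unique[OF mexp_component_sums])
    ultimately show ?thesis
      by (simp only: sums_iff)
  qed
  then have "((\<lambda>s. mexp A s $ i $ j) has_vector_derivative (A ** mexp A s) $ i $ j) (at s)" for i j
    by (simp add: has_real_derivative_iff_has_vector_derivative)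
  then have "(mexp A has_vector_derivative A ** mexp A s) (at s)"
    by (simp add: has_vector_derivative_def has_derivative_componentwise_within[of "mexp A"] Basis_vec_def
       inner_axis inner_axis')
  then show ?thesis by (rule has_vector_derivative_at_within)
qed

text \<open>\<open>A\<close> stands to the right of the exponential so that this term cancels
  \<open>A *v y\<close> when a solution is multiplied by \<open>mexp A (- s)\<close>.\<close>

lemma mexp_minus_has_vector_derivative:
  "((\<lambda>s. mexp A (- s)) has_vector_derivative - (mexp A (- s) ** A)) (at s within S)"
proof -
  have "((mexp A \<circ> uminus) has_vector_derivative (- 1) *\<^sub>R (A ** mexp A (- s))) (at s within S)"
    by (rule vector_diff_chain_within[OF _ mexp_has_vector_derivative]) (auto intro!: derivative_eq_intros)
  then show ?thesis by (simp add: o_def mexp_commute)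
qed

lemma continuous_on_mexp [continuous_intros]: "continuous_on S (mexp A)"
  by (rule continuous_on_vector_derivative) (rule mexp_has_vector_derivative)

lemma continuous_on_mexp_minus [continuous_intros]: "continuous_on S (\<lambda>s. mexp A (- s))"
  by (rule continuous_on_vector_derivative) (rule mexp_minus_has_vector_derivative)

text \<open>The derivatives of the two factors cancel because \<open>A\<close> commutes with its
  exponential; the product is constant and is evaluated at 0.\<close>

lemma mexp_mult_mexp_minus: "mexp A s ** mexp A (- s) = mat 1"
proof -
  let ?f = "\<lambda>s. mexp A s ** mexp A (- s)"
  have "(?f has_vector_derivative 0) (at s within UNIV)" for s
    using bounded_bilinear.has_vector_derivative[OF bounded_bilinear_matrix_matrix_mult
        mexp_has_vector_derivative[of A s UNIV] mexp_minus_has_vector_derivative[of A s UNIV]]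
    by (simp add: bounded_bilinear.minus_right[OF bounded_bilinear_matrix_matrix_mult]
        matrix_mul_assoc mexp_commute)
  then obtain c where c: "\<And>s. ?f s = c"
    using has_vector_derivative_zero_constant[of UNIV ?f] by auto
  from c[of s] c[of 0] show ?thesis by simp
qed

lemma mexp_minus_mult_mexp: "mexp A (- s) ** mexp A s = mat 1"
  using mexp_mult_mexp_minus[of A "- s"] by simp

text \<open>The partial sums of the series applied to \<open>x\<close> stay in \<open>R\<close>, and
  a subspace of a finite-dimensional space is closed.\<close>

lemma mexp_invariant:
  assumes "subspace R" "\<And>x. x \<in> R \<Longrightarrow> A *v x \<in> R" "x \<in> R"
  shows "mexp A s *v x \<in> R"
proof -
  have "mpow A k *v x \<in> R" for k
    by (induction k) (use assms in \<open>auto simp: mpow_Suc matrix_vector_mul_assoc[symmetric]\<close>)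
  then have R: "(s ^ k / fact k) *\<^sub>R mpow A k *v x \<in> R" for k
    using assms(1) by (simp add: bounded_bilinear.scaleR_left[OF bounded_bilinear_matrix_vector_mult] subspace_scale)
  have "(\<lambda>k. (s ^ k / fact k) *\<^sub>R mpow A k *v x) sums (mexp A s *v x)"
    by (rule bounded_linear.sums[OF bounded_bilinear.bounded_linear_left[OF bounded_bilinear_matrix_vector_mult] mexp_sums])
  then show ?thesis
    unfolding sums_def
    by (rule closed_sequentially[OF closed_subspace[OF assms(1)], rotated])
      (intro subspace_sum assms R)
qed


section \<open>Integration by parts for absolutely continuous functions\<close>

text \<open>The difference quotient at \<open>t\<close> is bounded by the absolute value of
  \<open>C * (G y - G t)\<close>, which tends to zero by continuity of \<open>G\<close>.\<close>

lemma zero_vector_derivative_of_increment_bound: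
  fixes F :: "real \<Rightarrow> 'a::real_normed_vector"
  assumes G: "continuous_on {a..b} G"
    and le: "\<And>s t. a \<le> s \<Longrightarrow> s \<le> t \<Longrightarrow> t \<le> b \<Longrightarrow> norm (F t - F s) \<le> C * (t - s) * (G t - G s)"
    and t: "t \<in> {a..b}"
  shows "(F has_vector_derivative 0) (at t within {a..b})"
proof -
  have lim: "((\<lambda>y. C * (G y - G t)) \<longlongrightarrow> 0) (at t within {a..b})"
  proof -
    have "(G \<longlongrightarrow> G t) (at t within {a..b})"
      using G t by (auto simp: continuous_on_def)
    then have "((\<lambda>y. C * (G y - G t)) \<longlongrightarrow> C * (G t - G t)) (at t within {a..b})"
      by (intro tendsto_intros)
    then show ?thesis by simp
  qed
  have "((\<lambda>y. norm ((1 / norm (y - t)) *\<^sub>R (F y - F t))) \<longlongrightarrow> 0) (at t within {a..b})"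
  proof (rule tendsto_sandwich[OF _ _ tendsto_const tendsto_rabs_zero[OF lim]])
    show "\<forall>\<^sub>F y in at t within {a..b}. norm ((1 / norm (y - t)) *\<^sub>R (F y - F t)) \<le> \<bar>C * (G y - G t)\<bar>"
    proof (rule eventually_at_topological[THEN iffD2], intro exI[of _ UNIV] conjI ballI impI)
      fix y assume "y \<noteq> t" "y \<in> {a..b}"
      have "norm (F y - F t) \<le> \<bar>y - t\<bar> * \<bar>C * (G y - G t)\<bar>"
      proof (cases "t \<le> y")
        case True
        then have "norm (F y - F t) \<le> (y - t) * (C * (G y - G t))"
          using le[of t y] t \<open>y \<in> {a..b}\<close> by (simp add: mult_ac)
        also have "\<dots> \<le> (y - t) * \<bar>C * (G y - G t)\<bar>"
          using True by (intro mult_left_mono) auto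
        finally show ?thesis using True by simp
      next
        case False
        then have "norm (F t - F y) \<le> (t - y) * (C * (G t - G y))"
          using le[of y t] t \<open>y \<in> {a..b}\<close> by (simp add: mult_ac)
        also have "\<dots> \<le> (t - y) * \<bar>C * (G t - G y)\<bar>"
          using False by (intro mult_left_mono) auto
        also have "C * (G t - G y) = - (C * (G y - G t))" by (simp add: algebra_simps)
        finally show ?thesis using False by (simp add: norm_minus_commute)
      qed
      then show "norm ((1 / norm (y - t)) *\<^sub>R (F y - F t)) \<le> \<bar>C * (G y - G t)\<bar>"
        using \<open>y \<noteq> t\<close> by (simp add: divide_le_eq mult.commute)
    qed auto
  qed auto
  then have "((\<lambda>y. (1 / norm (y - t)) *\<^sub>R (F y - F t)) \<longlongrightarrow> 0) (at t within {a..b})"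
    by (rule tendsto_norm_zero_cancel)
  then show ?thesis
    by (simp add: has_vector_derivative_def has_derivative_within bounded_linear_zero)
qed

text \<open>As \<open>y\<close> is only absolutely continuous, the product rule is not available. Instead, the difference of
  both sides has increments of size \<open>O((t - s) (G t - G s))\<close> with \<open>G t = (\<integral>\<^sub>a\<^sup>t \<bar>g\<bar>)\<close>, hence derivative zero.\<close>

lemma integral_by_parts_absolutely_continuous:
  fixes prod :: "'a::euclidean_space \<Rightarrow> 'b::euclidean_space \<Rightarrow> 'c::euclidean_space"
  assumes "bounded_bilinear prod"
    and \<phi>: "\<And>s. s \<in> {a..b} \<Longrightarrow> (\<phi> has_vector_derivative \<phi>' s) (at s within {a..b})"
    and \<phi>': "continuous_on {a..b} \<phi>'"
    and g: "g absolutely_integrable_on {a..b}"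
    and y: "\<And>t. t \<in> {a..b} \<Longrightarrow> y t = y0 + integral {a..t} g"
    and t: "t \<in> {a..b}"
  shows "prod (\<phi> t) (y t) = prod (\<phi> a) y0 + integral {a..t} (\<lambda>s. prod (\<phi>' s) (y s) + prod (\<phi> s) (g s))"
proof -
  interpret bounded_bilinear prod by fact
  obtain K where K: "\<And>x y. norm (prod x y) \<le> norm x * norm y * K" "K \<ge> 0"
    using nonneg_bounded by blast
  obtain L where L: "\<And>s. s \<in> {a..b} \<Longrightarrow> norm (\<phi>' s) \<le> L"
    using compact_imp_bounded[OF compact_continuous_image[OF \<phi>' compact_Icc]]
    unfolding bounded_iff by blast
  have "L \<ge> 0" using L[OF t] norm_ge_zero order_trans by blast
  have \<phi>c: "continuous_on {a..b} \<phi>"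
    by (rule continuous_on_vector_derivative) (rule \<phi>)
  have gi: "g integrable_on {s..t}" "(\<lambda>x. norm (g x)) integrable_on {s..t}" if "a \<le> s" "t \<le> b" for s t
    using absolutely_integrable_on_subinterval[OF g, of s t] that by (auto simp: absolutely_integrable_on_def)
  have yc: "continuous_on {a..b} y"
  proof -
    have "continuous_on {a..b} (\<lambda>t. y0 + integral {a..t} g)"
      by (intro continuous_intros indefinite_integral_continuous_1 gi) auto
    then show ?thesis by (rule continuous_on_eq) (simp add: y)
  qed
  define h where "h = (\<lambda>s. prod (\<phi>' s) (y s) + prod (\<phi> s) (g s))"
  have \<phi>g: "(\<lambda>s. prod (\<phi> s) (g s)) absolutely_integrable_on {a..b}"
    by (rule absolutely_integrable_bounded_measurable_product[OF _ _ _ _ g])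
      (use compact_imp_bounded[OF compact_continuous_image[OF \<phi>c compact_Icc]] assms(1) in
        \<open>auto simp: bilinear_conv_bounded_bilinear intro!: continuous_imp_measurable_on_sets_lebesgue \<phi>c\<close>)
  have i1: "(\<lambda>s. prod (\<phi>' s) (y s)) integrable_on {s..t}" if "a \<le> s" "t \<le> b" for s t
    by (intro integrable_continuous_real continuous_on continuous_on_subset[OF \<phi>'] continuous_on_subset[OF yc])
      (use that in auto)
  have i2: "(\<lambda>s. prod (\<phi> s) (g s)) integrable_on {s..t}" if "a \<le> s" "t \<le> b" for s t
    using absolutely_integrable_on_subinterval[OF \<phi>g, of s t] that by (auto simp: absolutely_integrable_on_def)
  have hi: "h integrable_on {s..t}" if "a \<le> s" "t \<le> b" for s t
    unfolding h_def by (intro integrable_add i1 i2 that)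
  define G where "G = (\<lambda>t. integral {a..t} (\<lambda>s. norm (g s)))"
  have Gc: "continuous_on {a..b} G"
    unfolding G_def by (intro indefinite_integral_continuous_1 gi) auto
  have Gd: "G t - G s = integral {s..t} (\<lambda>s. norm (g s))" if "a \<le> s" "s \<le> t" "t \<le> b" for s t
    using Henstock_Kurzweil_Integration.integral_combine[of a s t "\<lambda>s. norm (g s)"] gi[of a t] that
    by (auto simp: G_def algebra_simps)
  have yd: "y t - y s = integral {s..t} g" if "a \<le> s" "s \<le> t" "t \<le> b" for s t
    using Henstock_Kurzweil_Integration.integral_combine[of a s t g] gi[of a t] that y[of s] y[of t]
    by (auto simp: algebra_simps)
  have ynd: "norm (y t - y s) \<le> G t - G s" if "a \<le> s" "s \<le> t" "t \<le> b" for s t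
    unfolding yd[OF that] Gd[OF that]
    by (rule Henstock_Kurzweil_Integration.integral_norm_bound_integral) (use gi that in auto)
  have Gmono: "G s \<le> G t" if "a \<le> s" "s \<le> t" "t \<le> b" for s t
    using ynd[OF that] norm_ge_zero[of "y t - y s"] by linarith
  have \<phi>d: "(\<phi>' has_integral \<phi> t - \<phi> s) {s..t}" if "a \<le> s" "s \<le> t" "t \<le> b" for s t
    by (rule fundamental_theorem_of_calculus) (use that has_vector_derivative_within_subset[OF \<phi>, of _ "{s..t}"] in auto)
  have \<phi>nd: "norm (\<phi> t - \<phi> s) \<le> L * (t - s)" if "a \<le> s" "s \<le> t" "t \<le> b" for s t
    using has_integral_bound_real[OF \<open>L \<ge> 0\<close> finite.emptyI \<phi>d[OF that]] L that by auto
  define F where "F = (\<lambda>t. prod (\<phi> t) (y t) - integral {a..t} h)"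
  have "norm (F t - F s) \<le> (2 * L * K) * (t - s) * (G t - G s)" if st: "a \<le> s" "s \<le> t" "t \<le> b" for s t
  proof -
    have I: "integral {a..t} h - integral {a..s} h = integral {s..t} h"
      using Henstock_Kurzweil_Integration.integral_combine[of a s t h] hi[of a t] st by (auto simp: algebra_simps)
    \<comment> \<open>With \<open>y\<close> frozen at the right end \<open>t\<close> and
      \<open>\<phi>\<close> at the left end \<open>s\<close>, both integrals are explicit, and they
      add up to the exact increment of the product.\<close>
    have 1: "((\<lambda>r. prod (\<phi>' r) (y t)) has_integral prod (\<phi> t - \<phi> s) (y t)) {s..t}"
      using has_integral_linear[OF \<phi>d[OF st] bounded_linear_left[of "y t"]] by (simp add: o_def)
    have "(g has_integral y t - y s) {s..t}"
      using gi(1)[of s t] yd[OF st] st by (simp add: has_integral_integrable_integral)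
    from has_integral_linear[OF this bounded_linear_right[of "\<phi> s"]]
    have 2: "((\<lambda>r. prod (\<phi> s) (g r)) has_integral prod (\<phi> s) (y t - y s)) {s..t}"
      by (simp add: o_def)
    have "((\<lambda>r. prod (\<phi>' r) (y t) + prod (\<phi> s) (g r) - h r) has_integral
            prod (\<phi> t - \<phi> s) (y t) + prod (\<phi> s) (y t - y s) - integral {s..t} h) {s..t}"
      using hi[of s t] st by (intro has_integral_diff has_integral_add 1 2 integrable_integral) auto
    moreover have "prod (\<phi> t - \<phi> s) (y t) + prod (\<phi> s) (y t - y s) - integral {s..t} h = F t - F s"
      using I by (simp add: F_def diff_left diff_right algebra_simps)
    ultimately have Fi: "((\<lambda>r. prod (\<phi>' r) (y t) + prod (\<phi> s) (g r) - h r) has_integral F t - F s) {s..t}"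
      by simp
    \<comment> \<open>The two summands have the same integral; hence the factor 2 in the increment
      bound.\<close>
    have bi: "((\<lambda>r. L * (G t - G s) * K + L * (t - s) * K * norm (g r)) has_integral
      (t - s) * (L * (G t - G s) * K) + L * (t - s) * K * (G t - G s)) {s..t}"
    proof (rule has_integral_add)
      show "((\<lambda>r. L * (G t - G s) * K) has_integral (t - s) * (L * (G t - G s) * K)) {s..t}"
        using has_integral_const_real[of "L * (G t - G s) * K" s t] st by simp
      show "((\<lambda>r. L * (t - s) * K * norm (g r)) has_integral L * (t - s) * K * (G t - G s)) {s..t}"
        using gi(2)[of s t] Gd[OF st] st
        by (intro has_integral_mult_right) (simp add: has_integral_integrable_integral)
    qed
    have "norm (prod (\<phi>' r) (y t) + prod (\<phi> s) (g r) - h r)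
        \<le> L * (G t - G s) * K + L * (t - s) * K * norm (g r)" if r: "r \<in> {s..t}" for r
    proof -
      \<comment> \<open>Each remaining term contains an increment: that of \<open>y\<close> is
        controlled by \<open>G\<close>, that of \<open>\<phi>\<close> by \<open>L\<close> times the
        length.\<close>
      have "prod (\<phi>' r) (y t) + prod (\<phi> s) (g r) - h r = prod (\<phi>' r) (y t - y r) - prod (\<phi> r - \<phi> s) (g r)"
        by (simp add: h_def diff_left diff_right)
      also have "norm \<dots> \<le> norm (\<phi>' r) * norm (y t - y r) * K + norm (\<phi> r - \<phi> s) * norm (g r) * K"
        using norm_triangle_ineq4 K(1) by (meson add_mono order_trans)
      also have "\<dots> \<le> L * (G t - G s) * K + (L * (t - s)) * norm (g r) * K"
      proof (intro add_mono mult_right_mono mult_mono)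
        show "norm (y t - y r) \<le> G t - G s"
          using ynd[of r t] Gmono[of s r] r st by simp
        have "norm (\<phi> r - \<phi> s) \<le> L * (r - s)" using \<phi>nd[of s r] r st by simp
        also have "\<dots> \<le> L * (t - s)" using r \<open>L \<ge> 0\<close> by (intro mult_left_mono) auto
        finally show "norm (\<phi> r - \<phi> s) \<le> L * (t - s)" .
      qed (use r st L \<open>L \<ge> 0\<close> K(2) in auto)
      finally show ?thesis by (simp add: mult_ac)
    qed
    then have "norm (integral {s..t} (\<lambda>r. prod (\<phi>' r) (y t) + prod (\<phi> s) (g r) - h r))
      \<le> integral {s..t} (\<lambda>r. L * (G t - G s) * K + L * (t - s) * K * norm (g r))"
      using Fi bi by (intro Henstock_Kurzweil_Integration.integral_norm_bound_integral) auto
    then show ?thesis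
      unfolding integral_unique[OF Fi] integral_unique[OF bi] by (simp add: algebra_simps)
  qed
  then have "(F has_vector_derivative 0) (at t within {a..b})" if "t \<in> {a..b}" for t
    using zero_vector_derivative_of_increment_bound[OF Gc _ that] by blast
  then obtain c where c: "\<And>t. t \<in> {a..b} \<Longrightarrow> F t = c"
    using has_vector_derivative_zero_constant[of "{a..b}" F] by auto
  have "F t = F a" using c[of t] c[of a] t by simp
  then show ?thesis using y[of a] t by (simp add: F_def h_def algebra_simps)
qed


section \<open>Variation of constants\<close>

lemma integrable_lebesgue_on_iff:
  fixes f :: "'a::euclidean_space \<Rightarrow> 'b::euclidean_space"
  assumes "S \<in> sets lebesgue"
  shows "integrable (lebesgue_on S) f \<longleftrightarrow> f absolutely_integrable_on S"
  using assms by (simp add: set_integrable_def integrable_restrict_space)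

text \<open>Passage from Lebesgue integrals to the gauge integrals in which the integration by parts
  is stated.\<close>

lemma solves_iff:
  assumes "I \<subseteq> {0..}"
  shows "solves I A B y0 u y \<longleftrightarrow> continuous_on I y \<and>
    (\<forall>t\<in>I. (\<lambda>s. A *v y s + B *v u s) absolutely_integrable_on {0..t} \<and>
           y t = y0 + integral {0..t} (\<lambda>s. A *v y s + B *v u s))"
  unfolding solves_def using assms
  by (auto simp: integrable_lebesgue_on_iff lebesgue_integral_eq_integral)

lemma absolutely_integrable_continuous_matrix_mult:
  fixes \<Phi> :: "real \<Rightarrow> real^'m^'n"
  assumes "continuous_on {a..b} \<Phi>" "g absolutely_integrable_on {a..b}"
  shows "(\<lambda>s. \<Phi> s *v g s) absolutely_integrable_on {a..b}"
  by (rule absolutely_integrable_bounded_measurable_product[OF _ _ _ _ assms(2)])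
    (use assms compact_imp_bounded[OF compact_continuous_image[OF assms(1) compact_Icc]] in
      \<open>auto simp: bilinear_conv_bounded_bilinear bounded_bilinear_matrix_vector_mult
         intro!: continuous_imp_measurable_on_sets_lebesgue\<close>)

text \<open>For one direction a solution is multiplied by \<open>mexp A (- s)\<close> and integrated
  by parts; for the other the solution is built as \<open>mexp A t *v z t\<close>.\<close>

lemma vanishes_at_iff:
  fixes A :: "real^'n^'n" and B :: "real^'m^'n"
  assumes I: "I = {0..} \<or> I = {0..T}" and t: "t \<in> I"
    and u: "\<And>b. b \<in> I \<Longrightarrow> (\<lambda>s. B *v u s) absolutely_integrable_on {0..b}"
  shows "vanishes_at I A B y0 u t \<longleftrightarrow> y0 + integral {0..t} (\<lambda>s. mexp A (- s) *v (B *v u s)) = 0"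
proof
  have I0: "I \<subseteq> {0..}" using I by auto
  have sub: "{0..b} \<subseteq> I" if "b \<in> I" for b using I that by auto
  note bb = bounded_bilinear_matrix_vector_mult
  {
    assume "vanishes_at I A B y0 u t"
    then obtain y where y: "solves I A B y0 u y" "y t = 0"
      by (auto simp: vanishes_at_def)
    note y1 = y(1)[unfolded solves_iff[OF I0]]
    \<comment> \<open>The two terms with \<open>A\<close> cancel in the integrand and leave only the
      control.\<close>
    have "mexp A (- t) *v y t = mexp A (- 0) *v y0 + integral {0..t}
        (\<lambda>s. - (mexp A (- s) ** A) *v y s + mexp A (- s) *v (A *v y s + B *v u s))"
    proof (rule integral_by_parts_absolutely_continuous[OF bb mexp_minus_has_vector_derivative, where b = t])
      show "continuous_on {0..t} (\<lambda>s. - (mexp A (- s) ** A))"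
        by (intro continuous_on_minus continuous_on_const continuous_on_mexp_minus
           bounded_bilinear.continuous_on[OF bounded_bilinear_matrix_matrix_mult])
      show "\<And>r. r \<in> {0..t} \<Longrightarrow> y r = y0 + integral {0..r} (\<lambda>s. A *v y s + B *v u s)"
        using y1 sub[OF t] by blast
    qed (use y1 t I0 in auto)
    then show "y0 + integral {0..t} (\<lambda>s. mexp A (- s) *v (B *v u s)) = 0"
      using y(2) by (simp add: bounded_bilinear.minus_left[OF bb] bounded_bilinear.zero_right[OF bb]
          matrix_vector_right_distrib matrix_vector_mul_assoc)
  }
  assume 0: "y0 + integral {0..t} (\<lambda>s. mexp A (- s) *v (B *v u s)) = 0"
  define h where "h = (\<lambda>s. mexp A (- s) *v (B *v u s))"
  define z where "z = (\<lambda>t. y0 + integral {0..t} h)"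
  define y where "y = (\<lambda>t. mexp A t *v z t)"
  have h: "h absolutely_integrable_on {0..b}" if "b \<in> I" for b
    unfolding h_def by (intro absolutely_integrable_continuous_matrix_mult continuous_on_mexp_minus u that)
  have zc: "continuous_on {0..b} z" if "b \<in> I" for b
    unfolding z_def using h[OF that]
    by (intro continuous_intros indefinite_integral_continuous_1) (simp add: absolutely_integrable_on_def)
  have yc: "continuous_on {0..b} y" if "b \<in> I" for b
    unfolding y_def by (intro bounded_bilinear.continuous_on[OF bb] continuous_on_mexp zc that)
  have "continuous_on I y"
    unfolding continuous_on_def
  proof
    fix x assume x: "x \<in> I"
    \<comment> \<open>Continuity is local: on the half-line, a compact interval reaching beyond
      \<open>x\<close> has the same neighbourhood filter at \<open>x\<close>.\<close>
    obtain b where b: "b \<in> I" "x \<in> {0..b}" "at x within I = at x within {0..b}"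
    proof (cases "I = {0..}")
      case True
      have "at x within I = at x within {0..x+1}"
        by (rule at_within_nhd[of _ "{..<x+1}"]) (use True in auto)
      then show ?thesis using that[of "x+1"] x True by auto
    next
      case False
      then show ?thesis using that[of T] x I by auto
    qed
    then show "(y \<longlongrightarrow> y x) (at x within I)"
      using yc[OF b(1)] by (auto simp: continuous_on_def)
  qed
  moreover have "(\<lambda>s. A *v y s + B *v u s) absolutely_integrable_on {0..b} \<and>
           y b = y0 + integral {0..b} (\<lambda>s. A *v y s + B *v u s)" if "b \<in> I" for b
  proof
    show "(\<lambda>s. A *v y s + B *v u s) absolutely_integrable_on {0..b}"
      by (intro set_integral_add u that absolutely_integrable_continuous_real
          bounded_bilinear.continuous_on[OF bb] yc continuous_on_const)
    have "mexp A b *v z b = mexp A 0 *v y0 + integral {0..b}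
        (\<lambda>s. (A ** mexp A s) *v z s + mexp A s *v h s)"
    proof (rule integral_by_parts_absolutely_continuous[OF bb mexp_has_vector_derivative, where b = b])
      show "continuous_on {0..b} (\<lambda>s. A ** mexp A s)"
        by (intro continuous_on_const continuous_on_mexp
           bounded_bilinear.continuous_on[OF bounded_bilinear_matrix_matrix_mult])
    qed (use h that I0 in \<open>auto simp: z_def\<close>)
    then show "y b = y0 + integral {0..b} (\<lambda>s. A *v y s + B *v u s)"
      by (simp add: y_def h_def matrix_vector_mul_assoc mexp_mult_mexp_minus matrix_mul_assoc)
  qed
  ultimately have "solves I A B y0 u y"
    by (simp add: solves_iff[OF I0])
  moreover have "y t = 0"
    using 0 by (simp add: y_def z_def h_def bounded_bilinear.zero_right[OF bb])
  ultimately show "vanishes_at I A B y0 u t"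
    by (auto simp: vanishes_at_def)
qed


section \<open>The controllable subspace\<close>

lemma subspace_set_plus: "subspace S \<Longrightarrow> subspace T \<Longrightarrow> subspace (S + T)"
proof -
  have "S + T = {x + y |x y. x \<in> S \<and> y \<in> T}" by (auto simp: set_plus_def)
  then show "subspace S \<Longrightarrow> subspace T \<Longrightarrow> subspace (S + T)" by (simp add: subspace_sums)
qed

lemma image_matrix_set_plus: "(*v) A ` (S + T) = (*v) A ` S + (*v) A ` T"
  by (force simp: set_plus_def matrix_vector_right_distrib image_iff)

context
  fixes A :: "real^'n^'n" and B :: "real^'m^'n"
begin

text \<open>The number of summands is variable so that dimensions can be compared along the chain;
  index \<open>CARD('n)\<close> gives \<open>ctrl_space A B\<close>.\<close>

definition krylov :: "nat \<Rightarrow> (real^'n) set"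
  where "krylov k = (\<Sum>i\<le>k. ((*v) A ^^ i) ` range ((*v) B))"

lemma krylov_0: "krylov 0 = range ((*v) B)"
  by (simp add: krylov_def)

lemma krylov_Suc: "krylov (Suc k) = krylov k + ((*v) A ^^ Suc k) ` range ((*v) B)"
  by (simp add: krylov_def)

lemma linear_matrix_power: "linear ((*v) A ^^ k)"
proof (induction k)
  case (Suc k)
  then show ?case
    unfolding funpow.simps(2) by (intro linear_compose matrix_vector_mul_linear)
qed (simp add: linear_iff)

lemma subspace_krylov: "subspace (krylov k)"
proof (induction k)
  case 0
  show ?case unfolding krylov_0 by (intro linear_subspace_image matrix_vector_mul_linear subspace_UNIV)
next
  case (Suc k)
  then show ?case unfolding krylov_Suc
    by (intro subspace_set_plus linear_subspace_image linear_matrix_power matrix_vector_mul_linear subspace_UNIV)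
qed

lemma krylov_mono: "krylov k \<subseteq> krylov (Suc k)"
proof
  fix x assume "x \<in> krylov k"
  moreover have "0 \<in> ((*v) A ^^ Suc k) ` range ((*v) B)"
    by (intro subspace_0 linear_subspace_image linear_matrix_power matrix_vector_mul_linear subspace_UNIV)
  ultimately have "x + 0 \<in> krylov (Suc k)"
    unfolding krylov_Suc by (rule set_plus_intro)
  then show "x \<in> krylov (Suc k)" by simp
qed

text \<open>Unlike \<open>krylov_Suc\<close>, this recursion determines each space from its
  predecessor alone, so that one coincidence in the chain propagates.\<close>

lemma krylov_Suc': "krylov (Suc k) = range ((*v) B) + (*v) A ` krylov k"
proof (induction k)
  case (Suc k)
  have "krylov (Suc (Suc k)) = range ((*v) B) + (*v) A ` krylov k + ((*v) A ^^ Suc (Suc k)) ` range ((*v) B)"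
    using Suc by (simp only: krylov_Suc[of "Suc k"])
  also have "((*v) A ^^ Suc (Suc k)) ` range ((*v) B) = (*v) A ` ((*v) A ^^ Suc k) ` range ((*v) B)"
    by (simp add: image_comp o_assoc)
  finally show ?case
    by (simp only: krylov_Suc[of k] image_matrix_set_plus add.assoc)
qed (simp add: krylov_Suc krylov_0)

text \<open>Once the increasing chain of Krylov spaces is stationary it remains so.\<close>

lemma krylov_stationary: "krylov (Suc CARD('n)) = krylov CARD('n)"
proof -
  \<comment> \<open>Until the chain becomes stationary, every step raises the dimension by at least
    one. At \<open>CARD('n)\<close> the second alternative would exceed the dimension of the whole
    space.\<close>
  have "krylov (Suc k) = krylov k \<or> k < dim (krylov (Suc k))" for k
  proof (induction k)
    case 0
    have "krylov 1 = krylov 0" if "dim (krylov 1) = 0"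
      using that krylov_mono[of 0] subspace_0[OF subspace_krylov] by auto
    then show ?case by auto
  next
    case (Suc k)
    show ?case
    proof (cases "krylov (Suc (Suc k)) = krylov (Suc k)")
      case False
      then have "krylov (Suc k) \<noteq> krylov k"
        using krylov_Suc'[of k] krylov_Suc'[of "Suc k"] by auto
      then have "k < dim (krylov (Suc k))" using Suc by auto
      moreover have "\<not> dim (krylov (Suc (Suc k))) \<le> dim (krylov (Suc k))"
        using False subspace_dim_equal[OF subspace_krylov subspace_krylov krylov_mono] by metis
      ultimately show ?thesis by linarith
    qed auto
  qed
  from this[of "CARD('n)"] show ?thesis
    using dim_subset_UNIV_cart[of "krylov (Suc CARD('n))"] by auto
qed

lemma ctrl_space_eq_krylov: "ctrl_space A B = krylov CARD('n)"
  by (simp add: ctrl_space_def krylov_def)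

lemma subspace_ctrl_space: "subspace (ctrl_space A B)"
  by (simp add: ctrl_space_eq_krylov subspace_krylov)

lemma range_subset_ctrl_space: "B *v x \<in> ctrl_space A B"
proof -
  have "range ((*v) B) \<subseteq> krylov k" for k
    by (induction k) (use krylov_mono in \<open>auto simp: krylov_0\<close>)
  then show ?thesis by (auto simp: ctrl_space_eq_krylov)
qed

text \<open>\<open>A\<close> maps the Krylov space of index \<open>CARD('n)\<close> into the next
  one, which is the same by stationarity.\<close>

lemma ctrl_space_invariant: "z \<in> ctrl_space A B \<Longrightarrow> A *v z \<in> ctrl_space A B"
proof -
  assume "z \<in> ctrl_space A B"
  then have "B *v 0 + A *v z \<in> krylov (Suc CARD('n))"
    unfolding krylov_Suc' ctrl_space_eq_krylov by (intro set_plus_intro rangeI imageI)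
  then show ?thesis
    by (simp add: krylov_stationary ctrl_space_eq_krylov)
qed

lemma orthogonal_ctrl_space:
  assumes "\<And>i x. q \<bullet> (mpow A i *v (B *v x)) = 0" "z \<in> ctrl_space A B"
  shows "q \<bullet> z = 0"
proof -
  have "q \<bullet> z = 0" if "z \<in> krylov k" for k
    using that
  proof (induction k arbitrary: z)
    case 0
    then show ?case using assms(1)[of 0] by (auto simp: krylov_0)
  next
    case (Suc k)
    then obtain y x where y: "y \<in> krylov k" and z: "z = y + mpow A (Suc k) *v (B *v x)"
      unfolding krylov_Suc mpow_vector by (auto elim!: set_plus_elim)
    show ?case
      using Suc.IH[OF y] assms(1) by (simp only: z inner_add_right)
  qed
  then show ?thesis using assms(2) by (simp add: ctrl_space_eq_krylov)
qed

end

section \<open>Countability of simple zeros\<close>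

text \<open>By Lindelof, countably many of the isolating balls already cover the set, and each meets
  it only in its centre.\<close>

lemma countable_discrete:
  fixes X :: "'a::{metric_space, second_countable_topology} set"
  assumes "\<And>x. x \<in> X \<Longrightarrow> \<exists>d>0. \<forall>y\<in>X. dist y x < d \<longrightarrow> y = x"
  shows "countable X"
proof -
  obtain d where d: "\<And>x. x \<in> X \<Longrightarrow> d x > 0" "\<And>x y. x \<in> X \<Longrightarrow> y \<in> X \<Longrightarrow> dist y x < d x \<Longrightarrow> y = x"
    using assms by metis
  obtain F where F: "F \<subseteq> (\<lambda>x. ball x (d x)) ` X" "countable F" "\<Union>F = \<Union>((\<lambda>x. ball x (d x)) ` X)"
    using Lindelof[of "(\<lambda>x. ball x (d x)) ` X"] by (metis (no_types, lifting) imageE open_ball)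
  have "X \<subseteq> (\<Union>b\<in>F. b \<inter> X)"
    using F(3) d(1) by force
  moreover have "countable (b \<inter> X)" if b: "b \<in> F" for b
  proof -
    obtain x where x: "x \<in> X" "b = ball x (d x)" using F(1) b by blast
    have "b \<inter> X \<subseteq> {x}"
    proof
      fix y assume "y \<in> b \<inter> X"
      then have "y \<in> X" "dist y x < d x" by (simp_all add: x(2) dist_commute)
      then show "y \<in> {x}" using d(2)[OF x(1)] by blast
    qed
    then show ?thesis by (rule countable_subset) simp
  qed
  ultimately show ?thesis
    using F(2) by (blast intro: countable_subset[OF _ countable_UN])
qed

text \<open>The first-order expansion, with a remainder of at most half the linear term, excludes
  other zeros nearby. Off a countable set, vanishing thus passes from a function to its derivative,
  with no appeal to analyticity.\<close>

lemma countable_simple_zeros: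
  fixes f :: "real \<Rightarrow> 'a::real_normed_vector"
  assumes f: "\<And>x. (f has_vector_derivative f' x) (at x)"
  shows "countable {x. f x = 0 \<and> f' x \<noteq> 0}"
proof (rule countable_discrete)
  fix x assume "x \<in> {x. f x = 0 \<and> f' x \<noteq> 0}"
  then have x: "f x = 0" "norm (f' x) / 2 > 0" by auto
  then obtain d where d: "d > 0"
    "\<And>y. norm (y - x) < d \<Longrightarrow> norm (f y - f x - (y - x) *\<^sub>R f' x) \<le> norm (f' x) / 2 * norm (y - x)"
    using f[of x] unfolding has_vector_derivative_def has_derivative_at_alt by metis
  show "\<exists>d>0. \<forall>y\<in>{x. f x = 0 \<and> f' x \<noteq> 0}. dist y x < d \<longrightarrow> y = x"
  proof (intro exI[of _ d] conjI ballI impI)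
    fix y assume "y \<in> {x. f x = 0 \<and> f' x \<noteq> 0}" "dist y x < d"
    with d(2)[of y] x show "y = x"
      by (auto simp: dist_norm abs_mult mult_le_0_iff)
  qed fact
qed


section \<open>Steering with controls supported on a non-null set\<close>

lemma AE_lebesgue_on_iff_negligible:
  fixes P :: "'a::euclidean_space \<Rightarrow> bool"
  assumes "S \<in> sets lebesgue"
  shows "(AE t in lebesgue_on S. P t) \<longleftrightarrow> negligible {t \<in> S. \<not> P t}"
proof -
  have "(AE t in lebesgue_on S. P t) \<longleftrightarrow> (AE t in lebesgue. t \<in> S \<longrightarrow> P t)"
    using assms by (simp add: AE_restrict_space_iff)
  also have "\<dots> \<longleftrightarrow> negligible {t \<in> S. \<not> P t}"
  proof
    assume "AE t in lebesgue. t \<in> S \<longrightarrow> P t"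
    then obtain N where "N \<in> null_sets lebesgue" "{t \<in> S. \<not> P t} \<subseteq> N"
      by (auto simp: eventually_ae_filter)
    then show "negligible {t \<in> S. \<not> P t}"
      by (meson negligible_iff_null_sets negligible_subset)
  next
    assume "negligible {t \<in> S. \<not> P t}"
    then show "AE t in lebesgue. t \<in> S \<longrightarrow> P t"
      unfolding negligible_iff_null_sets eventually_ae_filter by auto
  qed
  finally show ?thesis .
qed

section \<open>Bounded controls and their moments\<close>

text \<open>The bound holds at every time of the whole line, so sums, multiples and restrictions
  involve no exceptional null sets. \<open>bounded_representative\<close> supplies such
  controls.\<close>

definition bounded_measurable :: "real \<Rightarrow> (real \<Rightarrow> real^'m) set"
  where "bounded_measurable C = {w \<in> borel_measurable lebesgue. \<forall>t. norm (w t) \<le> C}"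

text \<open>This is \<open>mexp A (- T)\<close> applied to the contribution of \<open>w\<close> to
  the state at time \<open>T\<close>.\<close>

definition moment :: "real^'n^'n \<Rightarrow> real^'m^'n \<Rightarrow> real \<Rightarrow> (real \<Rightarrow> real^'m) \<Rightarrow> real^'n"
  where "moment A B T w = integral {0..T} (\<lambda>s. mexp A (- s) *v (B *v w s))"

lemma bounded_measurable_scale: "w \<in> bounded_measurable C \<Longrightarrow> (\<lambda>t. c *\<^sub>R w t) \<in> bounded_measurable (\<bar>c\<bar> * C)"
  by (auto simp: bounded_measurable_def intro: mult_left_mono)

lemma bounded_measurable_add:
  "w \<in> bounded_measurable C \<Longrightarrow> w' \<in> bounded_measurable C' \<Longrightarrow> (\<lambda>t. w t + w' t) \<in> bounded_measurable (C + C')"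
  by (auto simp: bounded_measurable_def intro: norm_triangle_mono)

lemma bounded_measurable_0: "(\<lambda>t. 0) \<in> bounded_measurable 0"
  by (simp add: bounded_measurable_def)

lemma bounded_measurable_nonneg: "w \<in> bounded_measurable C \<Longrightarrow> C \<ge> 0"
proof -
  assume "w \<in> bounded_measurable C"
  then have "norm (w 0) \<le> C" by (simp add: bounded_measurable_def)
  then show "C \<ge> 0" using norm_ge_zero[of "w 0"] by linarith
qed

lemma bounded_measurable_restrict:
  assumes "w \<in> bounded_measurable C" "S \<in> sets lebesgue"
  shows "(\<lambda>t. if t \<in> S then w t else 0) \<in> bounded_measurable C"
proof -
  have "C \<ge> 0" using assms(1) by (rule bounded_measurable_nonneg)
  then show ?thesis using assms
    by (auto simp: bounded_measurable_def intro!: borel_measurable_if_I measurable_restrict_space1)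
qed

lemma bounded_measurable_sum:
  assumes "\<And>i. i \<in> F \<Longrightarrow> w i \<in> bounded_measurable (C i)" "finite F"
  shows "(\<lambda>t. \<Sum>i\<in>F. w i t) \<in> bounded_measurable (sum C F)"
  using assms(2,1) by (induction F) (auto intro: bounded_measurable_add simp: bounded_measurable_0)

lemma absolutely_integrable_bounded_control:
  assumes "w \<in> bounded_measurable C"
  shows "(\<lambda>s. B *v w s) absolutely_integrable_on {a..b}"
proof -
  have w: "w absolutely_integrable_on {a..b}"
    by (rule measurable_bounded_by_integrable_imp_absolutely_integrable[where g = "\<lambda>_. C"])
      (use assms in \<open>auto simp: bounded_measurable_def intro: measurable_restrict_space1\<close>)
  then show ?thesis
    by (intro absolutely_integrable_continuous_matrix_mult continuous_on_const)
qed

lemma moment_integrable: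
  assumes "w \<in> bounded_measurable C"
  shows "(\<lambda>s. mexp A (- s) *v (B *v w s)) integrable_on {a..b}"
  using absolutely_integrable_continuous_matrix_mult[OF continuous_on_mexp_minus
      absolutely_integrable_bounded_control[OF assms]]
  unfolding absolutely_integrable_on_def by blast

lemma moment_add:
  assumes "w \<in> bounded_measurable C" "w' \<in> bounded_measurable C'"
  shows "moment A B T (\<lambda>t. w t + w' t) = moment A B T w + moment A B T w'"
  unfolding moment_def
  by (simp add: matrix_vector_right_distrib Henstock_Kurzweil_Integration.integral_add[OF moment_integrable[OF assms(1)] moment_integrable[OF assms(2)]])

lemma moment_scale: "moment A B T (\<lambda>t. c *\<^sub>R w t) = c *\<^sub>R moment A B T w"
  by (simp add: moment_def bounded_bilinear.scaleR_right[OF bounded_bilinear_matrix_vector_mult])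

lemma moment_0: "moment A B T (\<lambda>t. 0) = 0"
  by (simp add: moment_def bounded_bilinear.zero_right[OF bounded_bilinear_matrix_vector_mult])

lemma moment_sum:
  assumes "\<And>i. i \<in> F \<Longrightarrow> w i \<in> bounded_measurable (C i)" "finite F"
  shows "moment A B T (\<lambda>t. \<Sum>i\<in>F. w i t) = (\<Sum>i\<in>F. moment A B T (w i))"
  using assms(2,1)
proof (induction F)
  case (insert i F)
  then show ?case
    using moment_add[of "w i" "C i" "\<lambda>t. \<Sum>i\<in>F. w i t" "sum C F" A B T] bounded_measurable_sum[of F w C] by simp
qed (simp add: moment_0)

lemma moment_AE_cong:
  assumes "AE t in lebesgue_on {0..T}. w t = w' t"
  shows "moment A B T w = moment A B T w'"
  unfolding moment_def
  by (rule integral_spike[where S = "{t \<in> {0..T}. w t \<noteq> w' t}"])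
    (use assms in \<open>auto simp: AE_lebesgue_on_iff_negligible\<close>)

text \<open>The component of the moment orthogonal to the controllable space is orthogonal to every
  value of the integrand, since that space is invariant under \<open>mexp\<close>; hence it is
  zero.\<close>

lemma moment_in_ctrl_space:
  assumes "w \<in> bounded_measurable C"
  shows "moment A B T w \<in> ctrl_space A B"
proof -
  obtain y z where y: "y \<in> span (ctrl_space A B)" and z: "\<And>x. x \<in> span (ctrl_space A B) \<Longrightarrow> orthogonal z x"
    and yz: "moment A B T w = y + z"
    using orthogonal_subspace_decomp_exists[of "ctrl_space A B" "moment A B T w"] by metis
  have sp: "span (ctrl_space A B) = ctrl_space A B"
    by (simp add: span_eq_iff subspace_ctrl_space)
  have "z \<bullet> moment A B T w = integral {0..T} (\<lambda>s. z \<bullet> (mexp A (- s) *v (B *v w s)))"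
    unfolding moment_def
    using integral_linear[OF moment_integrable[OF assms] bounded_linear_inner_right[of z]] by (simp add: o_def)
  also have "\<dots> = integral {0..T} (\<lambda>s. 0)"
    by (rule arg_cong[of _ _ "integral {0..T}"], rule ext)
      (intro z[unfolded sp orthogonal_def] mexp_invariant subspace_ctrl_space ctrl_space_invariant range_subset_ctrl_space)
  finally have "z \<bullet> z = 0"
    using z[OF y] by (simp add: yz inner_add_right orthogonal_def)
  then show ?thesis using y sp yz by simp
qed

text \<open>The part \<open>p\<close> of \<open>z\<close> orthogonal to all attained moments is
  shown to be zero, by testing \<open>p\<close> against one control built from \<open>p\<close>
  itself.\<close>

lemma steering_single:
  fixes A :: "real^'n^'n" and B :: "real^'m^'n"
  assumes S: "S \<in> sets lebesgue" "S \<subseteq> {0..T}" "\<not> negligible S" and z: "z \<in> ctrl_space A B"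
  shows "\<exists>w C. w \<in> bounded_measurable C \<and> (\<forall>t. t \<notin> S \<longrightarrow> w t = 0) \<and> moment A B T w = z"
proof -
  define V where "V = {x. \<exists>w C. w \<in> bounded_measurable C \<and> (\<forall>t. t \<notin> S \<longrightarrow> w t = 0) \<and> moment A B T w = x}"
  have VI: "moment A B T w \<in> V" if "w \<in> bounded_measurable C" "\<And>t. t \<notin> S \<Longrightarrow> w t = 0" for w C
    unfolding V_def using that by blast
  have "subspace V"
  proof (rule subspaceI)
    show "0 \<in> V" using VI[OF bounded_measurable_0] by (simp add: moment_0)
  next
    fix x y assume "x \<in> V" "y \<in> V"
    then obtain w C w' C' where w: "w \<in> bounded_measurable C" "w' \<in> bounded_measurable C'"
      "\<forall>t. t \<notin> S \<longrightarrow> w t = 0" "\<forall>t. t \<notin> S \<longrightarrow> w' t = 0" "moment A B T w = x" "moment A B T w' = y"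
      unfolding V_def by blast
    then show "x + y \<in> V"
      using VI[OF bounded_measurable_add[OF w(1,2)]] by (simp add: moment_add[OF w(1,2)])
  next
    fix c x assume "x \<in> V"
    then obtain w C where w: "w \<in> bounded_measurable C" "\<forall>t. t \<notin> S \<longrightarrow> w t = 0" "moment A B T w = x"
      unfolding V_def by blast
    then show "c *\<^sub>R x \<in> V"
      using VI[OF bounded_measurable_scale[OF w(1)]] by (simp add: moment_scale)
  qed
  then have spV: "span V = V" by (simp add: span_eq_iff)
  obtain v p where v: "v \<in> V" and p: "\<And>x. x \<in> V \<Longrightarrow> p \<bullet> x = 0" and zvp: "z = v + p"
    using orthogonal_subspace_decomp_exists[of V z] unfolding spV orthogonal_def by metis
  \<comment> \<open>The rows \<open>f k\<close> are, up to sign, the successive derivatives of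
    \<open>f 0\<close>. If all of them vanish at one time \<open>s\<close>, then
    \<open>p v* mexp A (- s)\<close> is orthogonal to the controllable space.\<close>
  define f where "f = (\<lambda>k s. p v* (mexp A (- s) ** (mpow A k ** B)))"
  have f_inner: "f k s \<bullet> x = p \<bullet> (mexp A (- s) *v (mpow A k *v (B *v x)))" for k s x
    by (simp add: f_def dot_lmul_matrix matrix_vector_mul_assoc matrix_mul_assoc)
  have f_deriv: "(f k has_vector_derivative - f (Suc k) s) (at s)" for k s
  proof -
    have lin: "bounded_linear (\<lambda>X. p v* (X ** (mpow A k ** B)))"
      unfolding linear_conv_bounded_linear[symmetric]
      by (auto intro!: linearI simp: vec_eq_iff vector_matrix_mult_def matrix_matrix_mult_def
          sum.distrib sum_distrib_left algebra_simps)
    have "(f k has_vector_derivative p v* (- (mexp A (- s) ** A) ** (mpow A k ** B))) (at s)"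
      unfolding f_def by (rule bounded_linear.has_vector_derivative[OF lin mexp_minus_has_vector_derivative])
    moreover have "p v* (- (mexp A (- s) ** A) ** (mpow A k ** B)) = - f (Suc k) s"
      using linear_neg[OF bounded_linear.linear[OF lin], of "mexp A (- s) ** A"]
      by (simp add: f_def mpow_Suc matrix_mul_assoc)
    ultimately show ?thesis by simp
  qed
  have f_cont: "continuous_on X (f k)" for k X
    by (rule continuous_on_vector_derivative) (rule has_vector_derivative_at_within, rule f_deriv)
  \<comment> \<open>Cut off to \<open>S\<close>, the row itself serves as a control: the inner
    product of \<open>p\<close> with its moment is the integral of its squared length.\<close>
  define w where "w = (\<lambda>s. if s \<in> S then f 0 s else 0)"
  obtain C where C: "\<And>s. s \<in> {0..T} \<Longrightarrow> norm (f 0 s) \<le> C"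
    using compact_imp_bounded[OF compact_continuous_image[OF f_cont[of "{0..T}" 0] compact_Icc]]
    unfolding bounded_iff by blast
  have "S \<noteq> {}" using S(3) by auto
  then have C0: "C \<ge> 0" using order_trans[OF norm_ge_zero C] S(2) by (meson ex_in_conv subsetD)
  have "norm (w s) \<le> C" for s
    using C C0 S(2) by (auto simp: w_def)
  moreover have "w \<in> borel_measurable lebesgue"
    unfolding w_def by (rule borel_measurable_if_I[OF continuous_imp_measurable_on_sets_lebesgue[OF f_cont S(1)] S(1)])
  ultimately have w: "w \<in> bounded_measurable C"
    by (simp add: bounded_measurable_def)
  have "0 = p \<bullet> moment A B T w"
    using p[OF VI[OF w]] by (simp add: w_def)
  also have "\<dots> = integral {0..T} (\<lambda>s. p \<bullet> (mexp A (- s) *v (B *v w s)))"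
    unfolding moment_def
    using integral_linear[OF moment_integrable[OF w] bounded_linear_inner_right[of p]] by (simp add: o_def)
  also have "(\<lambda>s. p \<bullet> (mexp A (- s) *v (B *v w s))) = (\<lambda>s. w s \<bullet> w s)"
    using f_inner[of 0] by (auto simp: w_def bounded_bilinear.zero_right[OF bounded_bilinear_matrix_vector_mult])
  finally have int0: "integral {0..T} (\<lambda>s. w s \<bullet> w s) = 0" by simp
  have "(\<lambda>s. w s \<bullet> w s) absolutely_integrable_on {0..T}"
  proof (rule measurable_bounded_by_integrable_imp_absolutely_integrable[where g = "\<lambda>_. C * C"])
    show "(\<lambda>s. w s \<bullet> w s) \<in> borel_measurable (lebesgue_on {0..T})"
      using w by (intro borel_measurable_inner measurable_restrict_space1) (auto simp: bounded_measurable_def)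
    show "norm (w s \<bullet> w s) \<le> C * C" for s
      using w C0 mult_mono[of "norm (w s)" C "norm (w s)" C]
      by (simp add: bounded_measurable_def dot_square_norm power2_eq_square)
  qed auto
  then have "integrable (lebesgue_on {0..T}) (\<lambda>s. w s \<bullet> w s)"
    by (simp add: integrable_lebesgue_on_iff)
  moreover from this have "integral\<^sup>L (lebesgue_on {0..T}) (\<lambda>s. w s \<bullet> w s) = 0"
    using int0 by (simp add: lebesgue_integral_eq_integral)
  ultimately have "AE s in lebesgue_on {0..T}. w s \<bullet> w s = 0"
    by (subst (asm) integral_nonneg_eq_0_iff_AE) auto
  then have N1: "negligible {s \<in> {0..T}. w s \<noteq> 0}"
    by (simp add: AE_lebesgue_on_iff_negligible)
  \<comment> \<open>These are the times where some \<open>f k\<close> vanishes while its derivative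
    does not. Outside of them, vanishing of \<open>f 0\<close> passes to every
    \<open>f k\<close>.\<close>
  define N2 where "N2 = (\<Union>k. {s. f k s = 0 \<and> - f (Suc k) s \<noteq> 0})"
  have "countable {s. f k s = 0 \<and> - f (Suc k) s \<noteq> 0}" for k
    by (rule countable_simple_zeros) (rule f_deriv)
  then have "countable N2"
    unfolding N2_def by (intro countable_UN) auto
  then have "negligible N2"
    by (simp add: negligible_iff_null_sets null_sets_completionI countable_imp_null_set_lborel)
  with N1 have "negligible ({s \<in> {0..T}. w s \<noteq> 0} \<union> N2)" by (rule negligible_Un)
  then have "\<not> S \<subseteq> {s \<in> {0..T}. w s \<noteq> 0} \<union> N2"
    using S(3) negligible_subset[of _ S] by metis
  then obtain s where s: "s \<in> S" "w s = 0" "s \<notin> N2" using S(2) by auto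
  have f0: "f k s = 0" for k
    by (induction k) (use s in \<open>auto simp: N2_def w_def\<close>)
  have "(p v* mexp A (- s)) \<bullet> (mpow A k *v (B *v x)) = 0" for k x
    using f_inner[of k s x] by (simp add: f0 dot_lmul_matrix)
  \<comment> \<open>Evaluation at \<open>mexp A s *v z\<close> cancels the exponential and leaves
    \<open>p \<bullet> z\<close>.\<close>
  from orthogonal_ctrl_space[OF this mexp_invariant[OF subspace_ctrl_space ctrl_space_invariant z, of s]]
  have "p \<bullet> z = 0"
    by (simp add: dot_lmul_matrix matrix_vector_mul_assoc mexp_minus_mult_mexp)
  then have "p \<bullet> p = 0" using p[OF v] by (simp add: zvp inner_add_right)
  then have "z \<in> V" using v zvp by simp
  then show ?thesis unfolding V_def by blast
qed

text \<open>Controls for an orthonormal basis are combined with the coordinates of the target, so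
  one constant serves all targets. A small error can then be corrected by a small control.\<close>

lemma steering:
  fixes A :: "real^'n^'n" and B :: "real^'m^'n"
  assumes S: "S \<in> sets lebesgue" "S \<subseteq> {0..T}" "\<not> negligible S"
  shows "\<exists>C\<ge>0. \<forall>z\<in>ctrl_space A B. \<exists>w \<in> bounded_measurable (C * norm z).
    (\<forall>t. t \<notin> S \<longrightarrow> w t = 0) \<and> moment A B T w = z"
proof -
  obtain F where F: "F \<subseteq> ctrl_space A B" "pairwise orthogonal F" "\<And>b. b \<in> F \<Longrightarrow> norm b = 1"
    "independent F" "card F = dim (ctrl_space A B)" "span F = ctrl_space A B"
    using orthonormal_basis_subspace[OF subspace_ctrl_space[of A B]] by blast
  have fin: "finite F" using F(4) by (rule independent_imp_finite)
  have "\<forall>b\<in>F. \<exists>w C. w \<in> bounded_measurable C \<and> (\<forall>t. t \<notin> S \<longrightarrow> w t = 0) \<and> moment A B T w = b"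
    using F(1) by (intro ballI steering_single S) auto
  from bchoice[OF this] obtain W where "\<forall>b\<in>F. \<exists>C. W b \<in> bounded_measurable C \<and>
      (\<forall>t. t \<notin> S \<longrightarrow> W b t = 0) \<and> moment A B T (W b) = b"
    by blast
  from bchoice[OF this] obtain C where W: "\<And>b. b \<in> F \<Longrightarrow> W b \<in> bounded_measurable (C b)"
    "\<And>b t. b \<in> F \<Longrightarrow> t \<notin> S \<Longrightarrow> W b t = 0" "\<And>b. b \<in> F \<Longrightarrow> moment A B T (W b) = b"
    by blast
  have C: "C b \<ge> 0" if "b \<in> F" for b
    using W(1)[OF that] by (rule bounded_measurable_nonneg)
  show ?thesis
  proof (intro exI[of _ "sum C F"] conjI ballI)
    show "0 \<le> sum C F" by (intro sum_nonneg C)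
    fix z assume z: "z \<in> ctrl_space A B"
    define w where "w = (\<lambda>t. \<Sum>b\<in>F. (z \<bullet> b) *\<^sub>R W b t)"
    have bd: "(\<lambda>t. (z \<bullet> b) *\<^sub>R W b t) \<in> bounded_measurable (\<bar>z \<bullet> b\<bar> * C b)" if "b \<in> F" for b
      by (rule bounded_measurable_scale[OF W(1)[OF that]])
    have "(\<Sum>b\<in>F. \<bar>z \<bullet> b\<bar> * C b) \<le> (\<Sum>b\<in>F. norm z * C b)"
    proof (intro sum_mono mult_right_mono C)
      fix b assume "b \<in> F"
      then show "\<bar>z \<bullet> b\<bar> \<le> norm z" using Cauchy_Schwarz_ineq2[of z b] F(3) by simp
    qed
    also have "\<dots> = sum C F * norm z" by (simp add: sum_distrib_left mult.commute)
    finally have le: "(\<Sum>b\<in>F. \<bar>z \<bullet> b\<bar> * C b) \<le> sum C F * norm z" .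
    have "w \<in> bounded_measurable (\<Sum>b\<in>F. \<bar>z \<bullet> b\<bar> * C b)"
      unfolding w_def by (rule bounded_measurable_sum[OF bd fin])
    then have "w \<in> bounded_measurable (sum C F * norm z)"
      using le by (auto simp: bounded_measurable_def intro: order_trans)
    moreover have "moment A B T w = z"
    proof -
      have "moment A B T w = (\<Sum>b\<in>F. moment A B T (\<lambda>t. (z \<bullet> b) *\<^sub>R W b t))"
        unfolding w_def by (rule moment_sum[OF bd fin])
      also have "\<dots> = (\<Sum>b\<in>F. (z \<bullet> b) *\<^sub>R b)"
        by (simp add: moment_scale W)
      also have "\<dots> = z"
        using orthonormal_basis_expand[of F z] F fin z by (simp add: inner_commute)
      finally show ?thesis .
    qed
    moreover have "\<forall>t. t \<notin> S \<longrightarrow> w t = 0" by (simp add: w_def W)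
    ultimately show "\<exists>w\<in>bounded_measurable (sum C F * norm z). (\<forall>t. t \<notin> S \<longrightarrow> w t = 0) \<and> moment A B T w = z"
      by blast
  qed
qed


section \<open>Bang-bang properties\<close>

lemma bounded_measurable_mono: "w \<in> bounded_measurable C \<Longrightarrow> C \<le> C' \<Longrightarrow> w \<in> bounded_measurable C'"
  by (auto simp: bounded_measurable_def intro: order_trans)

lemma moment_extend:
  assumes "w \<in> bounded_measurable C" "\<And>t. t \<notin> {0..a} \<Longrightarrow> w t = 0" "0 \<le> a" "a \<le> b"
  shows "moment A B b w = moment A B a w"
proof -
  have "integral {a..b} (\<lambda>s. mexp A (- s) *v (B *v w s)) = integral {a..b} (\<lambda>s. 0)"
  \<comment> \<open>\<open>w\<close> may be nonzero at \<open>a\<close> itself, which is a null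
    set.\<close>
  proof (rule integral_spike[of "{a}"])
    fix s assume "s \<in> {a..b} - {a}"
    then show "0 = mexp A (- s) *v (B *v w s)" using assms(2)[of s] by simp
  qed simp
  then show ?thesis
    using Henstock_Kurzweil_Integration.integral_combine[OF assms(3,4) moment_integrable[OF assms(1)], of A B]
    by (simp add: moment_def)
qed

lemma moment_restrict: "moment A B T (\<lambda>t. if t \<in> {0..T} then w t else 0) = moment A B T w"
  unfolding moment_def by (rule integral_cong) simp

section \<open>Feasible pairs of bound and horizon\<close>

text \<open>Common form of both problems: the minimal norm problem varies the bound
  \<open>M\<close>, the minimal time problem the horizon \<open>T\<close>.\<close>

definition feasible :: "real^'n^'n \<Rightarrow> real^'m^'n \<Rightarrow> real \<Rightarrow> real \<Rightarrow> real^'n \<Rightarrow> bool"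
  where "feasible A B M T y0 \<longleftrightarrow> (\<exists>v\<in>bounded_measurable M. y0 + moment A B T v = 0)"

text \<open>Having reached the origin, the state stays there under the zero control.\<close>

lemma feasible_extend:
  assumes "feasible A B M T y0" "0 \<le> T" "T \<le> T'"
  shows "feasible A B M T' y0"
proof -
  obtain v where v: "v \<in> bounded_measurable M" "y0 + moment A B T v = 0"
    using assms(1) unfolding feasible_def by blast
  define w where "w = (\<lambda>t. if t \<in> {0..T} then v t else 0)"
  have w: "w \<in> bounded_measurable M"
    unfolding w_def by (rule bounded_measurable_restrict[OF v(1)]) simp
  have "moment A B T' w = moment A B T w"
    by (rule moment_extend[OF w _ assms(2,3)]) (auto simp: w_def)
  also have "\<dots> = moment A B T v" unfolding w_def by (rule moment_restrict)
  finally have "y0 + moment A B T' w = 0" using v(2) by simp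
  then show ?thesis unfolding feasible_def using w by blast
qed

lemma feasible_imp_ctrl_space: "feasible A B M T y0 \<Longrightarrow> y0 \<in> ctrl_space A B"
proof -
  assume "feasible A B M T y0"
  then obtain v where v: "v \<in> bounded_measurable M" "y0 = - moment A B T v"
    unfolding feasible_def using eq_neg_iff_add_eq_0 by blast
  then show ?thesis
    using subspace_neg[OF subspace_ctrl_space moment_in_ctrl_space[OF v(1)]] by simp
qed

lemma not_negligible_Icc: "a < b \<Longrightarrow> \<not> negligible {a..b::real}"
  using negligible_interval(1)[of a b] by simp

lemma ctrl_space_imp_feasible:
  assumes "y0 \<in> ctrl_space A B" "T > 0"
  shows "\<exists>M. feasible A B M T y0"
proof -
  have "\<not> negligible {0..T}"
    using assms(2) by (rule not_negligible_Icc)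
  from steering_single[OF _ subset_refl this subspace_neg[OF subspace_ctrl_space assms(1)]]
  obtain w C where "w \<in> bounded_measurable C" "moment A B T w = - y0" by auto
  then show ?thesis unfolding feasible_def by (metis add.right_inverse)
qed

text \<open>Common source of both bang-bang properties: a convex combination of \<open>v\<close>
  with a control supported where \<open>v\<close> is small still steers \<open>y0\<close> to zero
  and lowers the bound on and off that set.\<close>

lemma smaller_control:
  fixes A :: "real^'n^'n" and B :: "real^'m^'n"
  assumes v: "v \<in> bounded_measurable M" "y0 + moment A B T v = 0" and M: "M > 0"
    and not_bb: "\<not> (AE t in lebesgue_on {0<..<T}. norm (v t) = M)"
  shows "\<exists>M'<M. feasible A B M' T y0"
proof -
  have vM: "norm (v t) \<le> M" for t using v(1) by (simp add: bounded_measurable_def)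
  \<comment> \<open>Countably many sublevel sets exhaust the times where the norm differs from
    \<open>M\<close>, so one of them is not negligible.\<close>
  define E where "E = (\<lambda>k::nat. {t \<in> {0<..<T}. norm (v t) \<le> M - 1 / real (Suc k)})"
  have "{t \<in> {0<..<T}. norm (v t) \<noteq> M} \<subseteq> (\<Union>k. E k)"
  proof
    fix t assume t: "t \<in> {t \<in> {0<..<T}. norm (v t) \<noteq> M}"
    then have "0 < M - norm (v t)" using vM[of t] by auto
    then obtain k where "1 / real (Suc k) < M - norm (v t)"
      using nat_approx_posE by blast
    then show "t \<in> (\<Union>k. E k)" using t by (auto simp: E_def intro!: exI[of _ k])
  qed
  then obtain k where k: "\<not> negligible (E k)"
    using not_bb negligible_countable_Union[of "range E"] negligible_subset
    by (auto simp: AE_lebesgue_on_iff_negligible)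
  define \<epsilon> where "\<epsilon> = 1 / real (Suc k)"
  have \<epsilon>: "\<epsilon> > 0" by (simp add: \<epsilon>_def)
  have vE: "norm (v t) \<le> M - \<epsilon>" if "t \<in> E k" for t
    using that by (simp add: E_def \<epsilon>_def)
  have "E k \<in> sets lebesgue"
  proof -
    have "v \<in> borel_measurable lebesgue" using v(1) by (simp add: bounded_measurable_def)
    then have "(\<lambda>t. norm (v t)) \<in> borel_measurable lebesgue" by simp
    then have "{t \<in> space lebesgue. norm (v t) \<le> M - \<epsilon>} \<in> sets lebesgue"
      by (rule borel_measurable_le[OF _ borel_measurable_const])
    then have "{t \<in> space lebesgue. norm (v t) \<le> M - \<epsilon>} \<inter> {0<..<T} \<in> sets lebesgue"
      by (rule sets.Int) simp
    also have "{t \<in> space lebesgue. norm (v t) \<le> M - \<epsilon>} \<inter> {0<..<T} = E k"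
      by (auto simp: E_def \<epsilon>_def)
    finally show ?thesis .
  qed
  moreover have "E k \<subseteq> {0..T}" by (auto simp: E_def)
  \<comment> \<open>The target \<open>- y0\<close> makes \<open>w\<close> a steering control in its
    own right, so convex combinations with \<open>v\<close> preserve the moment equation.\<close>
  moreover have "- y0 \<in> ctrl_space A B"
    using feasible_imp_ctrl_space subspace_neg[OF subspace_ctrl_space] v unfolding feasible_def by blast
  ultimately obtain w C where w: "w \<in> bounded_measurable C" "\<And>t. t \<notin> E k \<Longrightarrow> w t = 0"
    and wy: "moment A B T w = - y0"
    using steering_single[OF _ _ k] by metis
  have C: "C \<ge> 0" using w(1) by (rule bounded_measurable_nonneg)
  \<comment> \<open>\<open>w\<close> may use up at most half of the gap \<open>\<epsilon>\<close>;
    \<open>C + 1\<close> avoids division by zero, and the minimum keeps \<open>1 - \<delta>\<close>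
    nonnegative.\<close>
  define \<delta> where "\<delta> = min 1 (\<epsilon> / (2 * (C + 1)))"
  have \<delta>: "0 < \<delta>" "\<delta> \<le> 1" using \<epsilon> C by (auto simp: \<delta>_def)
  have "\<delta> * C \<le> \<epsilon> / (2 * (C + 1)) * (C + 1)"
    using \<epsilon> C by (intro mult_mono) (auto simp: \<delta>_def)
  also have "\<dots> = \<epsilon> / 2" using C by (simp add: field_simps)
  finally have \<delta>C: "\<delta> * C \<le> \<epsilon> / 2" .
  define v' where "v' = (\<lambda>t. (1 - \<delta>) *\<^sub>R v t + \<delta> *\<^sub>R w t)"
  \<comment> \<open>The first bound is for \<open>E k\<close>; the second is for its complement,
    where \<open>w\<close> vanishes, and is below \<open>M\<close> because \<open>M\<close> is
    positive.\<close>
  define M' where "M' = max (M - \<epsilon> / 2) ((1 - \<delta>) * M)"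
  have "M' < M" using \<epsilon> \<delta> M by (auto simp: M'_def)
  have bd: "(\<lambda>t. (1 - \<delta>) *\<^sub>R v t) \<in> bounded_measurable (\<bar>1 - \<delta>\<bar> * M)" "(\<lambda>t. \<delta> *\<^sub>R w t) \<in> bounded_measurable (\<bar>\<delta>\<bar> * C)"
    by (rule bounded_measurable_scale[OF v(1)] bounded_measurable_scale[OF w(1)])+
  have "norm (v' t) \<le> M'" for t
  proof (cases "t \<in> E k")
    case True
    have "norm (v' t) \<le> (1 - \<delta>) * norm (v t) + \<delta> * norm (w t)"
      unfolding v'_def using \<delta> norm_triangle_ineq[of "(1 - \<delta>) *\<^sub>R v t" "\<delta> *\<^sub>R w t"] by simp
    also have "\<dots> \<le> 1 * norm (v t) + \<delta> * C"
      using \<delta> w(1) by (intro add_mono mult_right_mono mult_left_mono) (auto simp: bounded_measurable_def)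
    also have "\<dots> \<le> M - \<epsilon> / 2" using vE[OF True] \<delta>C by simp
    finally show ?thesis by (simp add: M'_def)
  next
    case False
    then have "norm (v' t) = (1 - \<delta>) * norm (v t)" using \<delta> w(2) by (simp add: v'_def)
    also have "\<dots> \<le> (1 - \<delta>) * M" using \<delta> vM by (intro mult_left_mono) auto
    finally show ?thesis by (simp add: M'_def)
  qed
  then have v': "v' \<in> bounded_measurable M'"
    using bounded_measurable_add[OF bd] by (simp add: bounded_measurable_def v'_def)
  have "moment A B T v' = (1 - \<delta>) *\<^sub>R moment A B T v + \<delta> *\<^sub>R moment A B T w"
    unfolding v'_def by (simp add: moment_add[OF bd] moment_scale)
  also have "moment A B T v = - y0" using v(2) by (simp add: eq_neg_iff_add_eq_0 add.commute)
  finally have "y0 + moment A B T v' = 0" by (simp add: wy algebra_simps)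
  then show ?thesis using v' \<open>M' < M\<close> unfolding feasible_def by blast
qed

text \<open>Stopping slightly early leaves a small defect in the moment, and the slack
  \<open>M - M'\<close> pays for its correction.\<close>

lemma feasible_earlier:
  fixes A :: "real^'n^'n" and B :: "real^'m^'n"
  assumes f: "feasible A B M' \<tau> y0" and M: "M' < M" and \<tau>: "\<tau> > 0"
  shows "\<exists>\<tau>'. 0 < \<tau>' \<and> \<tau>' < \<tau> \<and> feasible A B M \<tau>' y0"
proof -
  obtain v where v: "v \<in> bounded_measurable M'" "y0 + moment A B \<tau> v = 0"
    using f unfolding feasible_def by blast
  \<comment> \<open>Corrections are confined to the first half of the interval, so \<open>C\<close>
    is fixed before the stopping time is chosen.\<close>
  have "\<not> negligible {0..\<tau>/2}"
    using \<tau> by (intro not_negligible_Icc) simp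
  then obtain C where C: "C \<ge> 0" "\<And>z. z \<in> ctrl_space A B \<Longrightarrow> \<exists>w \<in> bounded_measurable (C * norm z).
    (\<forall>t. t \<notin> {0..\<tau>/2} \<longrightarrow> w t = 0) \<and> moment A B (\<tau>/2) w = z"
    using steering[of "{0..\<tau>/2}" "\<tau>/2" A B] by auto
  have "continuous_on {0..\<tau>} (\<lambda>t. moment A B t v)"
    unfolding moment_def by (rule indefinite_integral_continuous_1[OF moment_integrable[OF v(1)]])
  then have "((\<lambda>t. moment A B t v) \<longlongrightarrow> moment A B \<tau> v) (at \<tau> within {0..\<tau>})"
    using \<tau> by (auto simp: continuous_on_def)
  moreover have e: "(M - M') / (C + 1) > 0" using M C by simp
  ultimately have "\<forall>\<^sub>F t in at \<tau> within {0..\<tau>}. dist (moment A B t v) (moment A B \<tau> v) < (M - M') / (C + 1)"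
    by (rule tendstoD)
  then obtain d where d: "d > 0" "\<And>t. t \<in> {0..\<tau>} \<Longrightarrow> t \<noteq> \<tau> \<Longrightarrow> dist t \<tau> < d \<Longrightarrow>
      dist (moment A B t v) (moment A B \<tau> v) < (M - M') / (C + 1)"
    unfolding eventually_at by auto
  \<comment> \<open>Close enough to \<open>\<tau>\<close> for the defect to be small, and not before
    \<open>\<tau>/2\<close>, so that the correction is complete.\<close>
  define \<tau>' where "\<tau>' = max (\<tau>/2) (\<tau> - d/2)"
  have \<tau>': "0 < \<tau>'" "\<tau>' < \<tau>" "\<tau>/2 \<le> \<tau>'" using \<tau> d(1) by (auto simp: \<tau>'_def)
  define z where "z = moment A B \<tau> v - moment A B \<tau>' v"
  have "dist \<tau>' \<tau> < d" using d(1) \<tau> by (auto simp: \<tau>'_def dist_real_def)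
  then have nz: "norm z < (M - M') / (C + 1)"
    using d(2)[of \<tau>'] \<tau>' by (simp add: z_def dist_norm norm_minus_commute)
  have "z \<in> ctrl_space A B"
    unfolding z_def by (intro subspace_diff subspace_ctrl_space moment_in_ctrl_space[OF v(1)])
  from C(2)[OF this] obtain w where w: "w \<in> bounded_measurable (C * norm z)"
    "\<And>t. t \<notin> {0..\<tau>/2} \<Longrightarrow> w t = 0" "moment A B (\<tau>/2) w = z"
    by blast
  have "moment A B \<tau>' w = z"
    using moment_extend[OF w(1,2) _ \<tau>'(3), of A B] \<tau> w(3) by simp
  then have "y0 + moment A B \<tau>' (\<lambda>t. v t + w t) = 0"
    using v(2) by (simp add: moment_add[OF v(1) w(1)] z_def)
  moreover have "C * norm z \<le> M - M'"
  proof -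
    have "C * norm z \<le> (C + 1) * norm z" by (intro mult_right_mono) auto
    also have "\<dots> \<le> M - M'" using nz C(1) by (simp add: field_simps)
    finally show ?thesis .
  qed
  then have "(\<lambda>t. v t + w t) \<in> bounded_measurable M"
    using bounded_measurable_mono[OF bounded_measurable_add[OF v(1) w(1)]] by simp
  ultimately show ?thesis unfolding feasible_def using \<tau>' by blast
qed

section \<open>Essential bounds and bounded representatives\<close>

lemma Linf_norm_le_iff:
  assumes "v \<in> borel_measurable (lebesgue_on S)"
  shows "Linf_norm S v \<le> ereal M \<longleftrightarrow> (AE t in lebesgue_on S. norm (v t) \<le> M)"
proof
  assume "Linf_norm S v \<le> ereal M"
  then show "AE t in lebesgue_on S. norm (v t) \<le> M"
    using esssup_AE[of "\<lambda>t. ereal (norm (v t))" "lebesgue_on S"]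
    unfolding Linf_norm_def by (elim eventually_mono) (metis ereal_less_eq(3) order_trans)
next
  assume "AE t in lebesgue_on S. norm (v t) \<le> M"
  then show "Linf_norm S v \<le> ereal M"
    unfolding Linf_norm_def using assms by (intro esssup_I) auto
qed

text \<open>Over an empty interval the essential supremum would be minus infinity; positive length
  excludes this.\<close>

lemma Linf_norm_nonneg:
  assumes "T > 0"
  shows "0 \<le> Linf_norm {0<..<T} v"
proof -
  have "emeasure (lebesgue_on {0<..<T}) (space (lebesgue_on {0<..<T})) \<noteq> 0"
    using assms by (simp add: emeasure_restrict_space)
  then have "esssup (lebesgue_on {0<..<T}) (\<lambda>t. 0::ereal) = 0"
    by (rule esssup_const)
  then show ?thesis
    using esssup_mono[of "\<lambda>t. 0::ereal" "lebesgue_on {0<..<T}" "\<lambda>t. ereal (norm (v t))"]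
    by (simp add: Linf_norm_def)
qed

text \<open>The value zero is substituted outside \<open>S\<close> and on the null set where the
  bound fails.\<close>

lemma bounded_representative:
  assumes S: "S \<in> sets lebesgue" and v: "v \<in> borel_measurable (lebesgue_on S)"
    and M: "AE t in lebesgue_on S. norm (v t) \<le> M" "M \<ge> 0"
  shows "\<exists>v'\<in>bounded_measurable M. AE t in lebesgue_on S. v' t = v t"
proof -
  define f where "f = (\<lambda>t. if t \<in> S then v t else 0)"
  have f: "f \<in> borel_measurable lebesgue"
    unfolding f_def by (rule borel_measurable_if_I[OF v S])
  define v' where "v' = (\<lambda>t. if norm (f t) \<le> M then f t else 0)"
  have "v' \<in> bounded_measurable M"
    using f M(2) unfolding v'_def bounded_measurable_def
    by (auto intro!: measurable_If borel_measurable_le)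
  moreover have "AE t in lebesgue_on S. v' t = v t"
    using M(1) AE_space by eventually_elim (use S in \<open>auto simp: v'_def f_def\<close>)
  ultimately show ?thesis by blast
qed

text \<open>A change of the control on a null set affects neither the integrability nor the
  moment.\<close>

lemma vanishes_at_iff_moment:
  fixes A :: "real^'n^'n" and B :: "real^'m^'n"
  assumes I: "I = {0..} \<or> I = {0..T}" and t: "t \<in> I"
    and u': "u' \<in> bounded_measurable C" and N: "negligible {s \<in> I. u' s \<noteq> u s}"
  shows "vanishes_at I A B y0 u t \<longleftrightarrow> y0 + moment A B t u' = 0"
proof -
  have sub: "{0..b} \<subseteq> I" if "b \<in> I" for b using I that by auto
  have "(\<lambda>s. B *v u s) absolutely_integrable_on {0..b}" if "b \<in> I" for b
    by (rule absolutely_integrable_spike[OF absolutely_integrable_bounded_control[OF u'] N])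
      (use sub[OF that] in auto)
  from vanishes_at_iff[OF I t this]
  have "vanishes_at I A B y0 u t \<longleftrightarrow> y0 + moment A B t u = 0"
    by (simp add: moment_def)
  moreover have "negligible {s \<in> {0..t}. u' s \<noteq> u s}"
    by (rule negligible_subset[OF N]) (use sub[OF t] in auto)
  then have "moment A B t u' = moment A B t u"
    by (intro moment_AE_cong) (simp add: AE_lebesgue_on_iff_negligible)
  ultimately show ?thesis by simp
qed

lemma NP_admissible_representative:
  assumes T: "T > 0" and v: "NP_admissible A B T y0 v" and M: "Linf_norm {0<..<T} v \<le> ereal M"
  shows "\<exists>v'\<in>bounded_measurable M. (AE t in lebesgue_on {0<..<T}. v' t = v t) \<and> y0 + moment A B T v' = 0"
proof -
  have vm: "v \<in> borel_measurable (lebesgue_on {0<..<T})" and van: "vanishes_at {0..T} A B y0 v T"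
    using v by (auto simp: NP_admissible_def Linf_def)
  have "0 \<le> M" using order_trans[OF Linf_norm_nonneg[OF T] M] by simp
  then obtain v' where v': "v' \<in> bounded_measurable M" "AE t in lebesgue_on {0<..<T}. v' t = v t"
    using bounded_representative[OF _ vm] M by (auto simp: Linf_norm_le_iff[OF vm])
  \<comment> \<open>The control is given on the open interval but the state on the closed one; the
    endpoints form a null set.\<close>
  then have "negligible ({t \<in> {0<..<T}. v' t \<noteq> v t} \<union> {0, T})"
    by (auto simp: AE_lebesgue_on_iff_negligible)
  then have "negligible {t \<in> {0..T}. v' t \<noteq> v t}"
    by (rule negligible_subset) (auto simp: less_le)
  then have "y0 + moment A B T v' = 0"
    using vanishes_at_iff_moment[of "{0..T}" T T v' M v A B y0] v'(1) van T by auto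
  with v' show ?thesis by blast
qed

lemma bounded_measurable_NP_admissible:
  assumes "T > 0" "v \<in> bounded_measurable M" "y0 + moment A B T v = 0"
  shows "NP_admissible A B T y0 v" "Linf_norm {0<..<T} v \<le> ereal M"
proof -
  have vm: "v \<in> borel_measurable (lebesgue_on {0<..<T})"
    using assms(2) by (auto simp: bounded_measurable_def intro: measurable_restrict_space1)
  then show le: "Linf_norm {0<..<T} v \<le> ereal M"
    using assms(2) by (simp add: Linf_norm_le_iff bounded_measurable_def)
  have "vanishes_at {0..T} A B y0 v T"
    using vanishes_at_iff_moment[of "{0..T}" T T v M v A B y0] assms by auto
  then show "NP_admissible A B T y0 v"
    using vm le by (auto simp: NP_admissible_def Linf_def intro: le_less_trans)
qed

lemma bounded_controls_representative:
  assumes "u \<in> bounded_controls M" "M \<ge> 0" "t \<ge> 0" "vanishes_at {0..} A B y0 u t"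
  shows "\<exists>u'\<in>bounded_measurable M. (AE s in lebesgue_on {0..}. u' s = u s) \<and> y0 + moment A B t u' = 0"
proof -
  have um: "u \<in> borel_measurable (lebesgue_on {0..})"
    using assms by (simp add: bounded_controls_def)
  then have "AE s in lebesgue_on {0..}. norm (u s) \<le> M"
    using assms(1) by (simp add: bounded_controls_def Linf_norm_le_iff)
  then obtain u' where u': "u' \<in> bounded_measurable M" "AE s in lebesgue_on {0..}. u' s = u s"
    using bounded_representative[OF _ um _ assms(2)] by auto
  then have "y0 + moment A B t u' = 0"
    using vanishes_at_iff_moment[of "{0..}" T t u' M u A B y0] assms(3,4)
    by (auto simp: AE_lebesgue_on_iff_negligible)
  with u' show ?thesis by blast
qed

lemma feasible_bounded_controls:
  assumes "feasible A B M t y0" "t \<ge> 0"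
  shows "\<exists>u\<in>bounded_controls M. vanishes_at {0..} A B y0 u t"
proof -
  obtain u where u: "u \<in> bounded_measurable M" "y0 + moment A B t u = 0"
    using assms(1) unfolding feasible_def by blast
  have um: "u \<in> borel_measurable (lebesgue_on {0..})"
    using u(1) by (auto simp: bounded_measurable_def intro: measurable_restrict_space1)
  then have "u \<in> bounded_controls M"
    using u(1) by (simp add: bounded_controls_def Linf_norm_le_iff bounded_measurable_def)
  moreover have "vanishes_at {0..} A B y0 u t"
    using vanishes_at_iff_moment[of "{0..}" T t u M u A B y0] u assms(2) by auto
  ultimately show ?thesis by blast
qed

section \<open>The minimal norm as a function of the horizon\<close>

lemma min_norm_le:
  assumes "T > 0" "feasible A B M T y0"
  shows "min_norm A B T y0 \<le> ereal M"
proof -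
  obtain v where v: "v \<in> bounded_measurable M" "y0 + moment A B T v = 0"
    using assms(2) unfolding feasible_def by blast
  have "min_norm A B T y0 \<le> Linf_norm {0<..<T} v"
    unfolding min_norm_def using bounded_measurable_NP_admissible(1)[OF assms(1) v] by (intro Inf_lower) auto
  also have "\<dots> \<le> ereal M"
    by (rule bounded_measurable_NP_admissible(2)[OF assms(1) v])
  finally show ?thesis .
qed

lemma NP_admissible_feasible:
  assumes "T > 0" "NP_admissible A B T y0 v" "Linf_norm {0<..<T} v \<le> ereal M"
  shows "feasible A B M T y0"
  using NP_admissible_representative[OF assms] unfolding feasible_def by blast

lemma NP_admissible_norm:
  assumes "T > 0" "NP_admissible A B T y0 v"
  obtains r where "r \<ge> 0" "Linf_norm {0<..<T} v = ereal r"
proof -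
  have "Linf_norm {0<..<T} v < \<infinity>" using assms(2) by (simp add: NP_admissible_def Linf_def)
  then show thesis
    using Linf_norm_nonneg[OF assms(1), of v] that by (cases "Linf_norm {0<..<T} v") auto
qed

text \<open>The strict inequality provides a control of norm below \<open>M\<close> without the
  infimum being attained.\<close>

lemma min_norm_less_feasible:
  assumes "T > 0" "min_norm A B T y0 < ereal M"
  shows "feasible A B M T y0"
proof -
  obtain v where "NP_admissible A B T y0 v" "Linf_norm {0<..<T} v < ereal M"
    using assms(2) unfolding min_norm_def Inf_less_iff by auto
  then show ?thesis by (intro NP_admissible_feasible[OF assms(1)]) auto
qed

lemma min_norm_antimono:
  assumes "T > 0" "T \<le> T'"
  shows "min_norm A B T' y0 \<le> min_norm A B T y0"
  unfolding min_norm_def[of A B T]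
proof (rule Inf_greatest)
  fix x assume "x \<in> {Linf_norm {0<..<T} v |v. NP_admissible A B T y0 v}"
  then obtain v where v: "NP_admissible A B T y0 v" "x = Linf_norm {0<..<T} v" by auto
  obtain r where r: "Linf_norm {0<..<T} v = ereal r"
    using NP_admissible_norm[OF assms(1) v(1)] by metis
  have "feasible A B r T y0"
    using NP_admissible_feasible[OF assms(1) v(1)] r by simp
  then have "feasible A B r T' y0"
    using feasible_extend assms by (meson less_imp_le)
  then show "min_norm A B T' y0 \<le> x"
    using min_norm_le[of T'] assms v(2) r by auto
qed

text \<open>A decreasing function converges to its infimum. In this form, membership in
  \<open>D_bbp\<close> yields a horizon whose minimal norm is below \<open>M\<close>.\<close>

lemma Lim_min_norm: "Lim at_top (\<lambda>T. min_norm A B T y0) = (INF T\<in>{0<..}. min_norm A B T y0)"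
proof (rule tendsto_Lim)
  show "((\<lambda>T. min_norm A B T y0) \<longlongrightarrow> (INF T\<in>{0<..}. min_norm A B T y0)) at_top"
  proof (rule decreasing_tendsto)
    show "\<forall>\<^sub>F T in at_top. (INF T\<in>{0<..}. min_norm A B T y0) \<le> min_norm A B T y0"
      using eventually_gt_at_top[of 0] by eventually_elim (auto intro: INF_lower)
    fix x assume "(INF T\<in>{0<..}. min_norm A B T y0) < x"
    then obtain T where T: "T > 0" "min_norm A B T y0 < x" by (auto simp: INF_less_iff)
    show "\<forall>\<^sub>F T in at_top. min_norm A B T y0 < x"
      using eventually_ge_at_top[of T]
      by eventually_elim (use T min_norm_antimono in \<open>blast intro: le_less_trans\<close>)
  qed
qed simp

section \<open>Conclusions for the two control problems\<close>

text \<open>A minimal norm control violating the bang-bang property would be beaten by the one from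
  \<open>smaller_control\<close>.\<close>

lemma NP_bang_bang_ctrl_space:
  fixes A :: "real^'n^'n" and B :: "real^'m^'n"
  assumes T: "T > 0" and y0: "y0 \<in> ctrl_space A B"
  shows "NP_bang_bang A B T y0"
  unfolding NP_bang_bang_def
proof (intro conjI allI impI)
  show "\<exists>v. NP_admissible A B T y0 v"
    using ctrl_space_imp_feasible[OF y0 T] bounded_measurable_NP_admissible[OF T] unfolding feasible_def by blast
  fix v assume "min_norm_control A B T y0 v"
  then have v: "NP_admissible A B T y0 v" "Linf_norm {0<..<T} v = min_norm A B T y0"
    by (auto simp: min_norm_control_def)
  obtain r where r: "r \<ge> 0" "Linf_norm {0<..<T} v = ereal r"
    by (rule NP_admissible_norm[OF T v(1)])
  obtain v' where v': "v' \<in> bounded_measurable r" "AE t in lebesgue_on {0<..<T}. v' t = v t"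
    "y0 + moment A B T v' = 0"
    using NP_admissible_representative[OF T v(1)] r(2) by auto
  have "AE t in lebesgue_on {0<..<T}. norm (v' t) = r"
  \<comment> \<open>\<open>smaller_control\<close> requires a positive bound. With
    \<open>r = 0\<close> the representative vanishes identically, which forces
    \<open>y0 = 0\<close>.\<close>
  proof (cases "r = 0")
    case True
    then show ?thesis using v'(1) by (simp add: bounded_measurable_def)
  next
    case False
    show ?thesis
    proof (rule ccontr)
      assume "\<not> ?thesis"
      then obtain M' where "M' < r" "feasible A B M' T y0"
        using smaller_control[OF v'(1,3)] False r(1) by auto
      then have "ereal r \<le> ereal M'" using min_norm_le[OF T] v(2) r(2) by metis
      then show False using \<open>M' < r\<close> by simp
    qed
  qed
  then show "AE t in lebesgue_on {0<..<T}. ereal (norm (v t)) = min_norm A B T y0"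
    using v'(2) by eventually_elim (use v(2) r(2) in auto)
qed

lemma NP_admissible_imp_ctrl_space:
  assumes "T > 0" "NP_admissible A B T y0 v"
  shows "y0 \<in> ctrl_space A B"
proof -
  obtain r where "Linf_norm {0<..<T} v = ereal r" by (rule NP_admissible_norm[OF assms])
  then show ?thesis using NP_admissible_feasible[OF assms] feasible_imp_ctrl_space by force
qed

text \<open>A violation permits a smaller bound at the same time by \<open>smaller_control\<close>,
  hence the original bound at an earlier time by \<open>feasible_earlier\<close>, against
  minimality.\<close>

lemma TP_bang_bang_D_bbp:
  fixes A :: "real^'n^'n" and B :: "real^'m^'n"
  assumes "(M, y0) \<in> D_bbp A B"
  shows "TP_bang_bang A B M y0"
  unfolding TP_bang_bang_def
proof (intro conjI allI impI)
  have M: "M > 0" and lim: "(INF T\<in>{0<..}. min_norm A B T y0) < ereal M"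
    using assms by (auto simp: D_bbp_def Lim_min_norm)
  obtain T where "T > 0" "min_norm A B T y0 < ereal M"
    using lim by (auto simp: INF_less_iff)
  then show "\<exists>u. TP_admissible A B M y0 u"
    using feasible_bounded_controls[OF min_norm_less_feasible] unfolding TP_admissible_def
    by (meson less_imp_le)
  fix u assume "min_time_control A B M y0 u"
  then obtain \<tau> where \<tau>: "min_time A B M y0 = ereal \<tau>" and u: "u \<in> bounded_controls M" "vanishes_at {0..} A B y0 u \<tau>"
    by (auto simp: min_time_control_def)
  have set: "{t. 0 < t \<and> ereal t < min_time A B M y0} = {0<..<\<tau>}" by (auto simp: \<tau>)
  show "AE t in lebesgue_on {t. 0 < t \<and> ereal t < min_time A B M y0}. norm (u t) = M"
    unfolding set
  \<comment> \<open>A nonpositive minimal time is not excluded here; the interval is then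
    empty.\<close>
  proof (cases "\<tau> > 0")
    case False
    then have "{0<..<\<tau>} = {}" by auto
    then show "AE t in lebesgue_on {0<..<\<tau>}. norm (u t) = M"
      by (simp add: AE_lebesgue_on_iff_negligible)
  next
    case True
    obtain u' where u': "u' \<in> bounded_measurable M" "AE s in lebesgue_on {0..}. u' s = u s" "y0 + moment A B \<tau> u' = 0"
      using bounded_controls_representative[OF u(1) _ _ u(2)] M True by auto
    have "AE t in lebesgue_on {0<..<\<tau>}. norm (u' t) = M"
    proof (rule ccontr)
      assume "\<not> ?thesis"
      then obtain M' where "M' < M" "feasible A B M' \<tau> y0"
        using smaller_control[OF u'(1,3) M] by auto
      then obtain \<tau>' where \<tau>': "0 < \<tau>'" "\<tau>' < \<tau>" "feasible A B M \<tau>' y0"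
        using feasible_earlier True by blast
      have "min_time A B M y0 \<le> ereal \<tau>'"
        unfolding min_time_def using feasible_bounded_controls[OF \<tau>'(3)] \<tau>'(1) by (intro Inf_lower) auto
      then show False using \<tau> \<tau>'(2) by simp
    qed
    moreover have "negligible {t \<in> {0<..<\<tau>}. u' t \<noteq> u t}"
      using u'(2) by (rule_tac negligible_subset) (auto simp: AE_lebesgue_on_iff_negligible)
    then have "AE t in lebesgue_on {0<..<\<tau>}. u' t = u t"
      by (simp add: AE_lebesgue_on_iff_negligible)
    ultimately show "AE t in lebesgue_on {0<..<\<tau>}. norm (u t) = M"
      by eventually_elim auto
  qed
qed

text \<open>A control steering to zero at time \<open>t\<close>, extended by zero, is not bang-bang on \<open>(0, t + 1)\<close>;
  hence the minimal norm at \<open>t + 1\<close> is strictly below its bound.\<close>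

lemma TP_admissible_imp_D_bbp:
  fixes A :: "real^'n^'n" and B :: "real^'m^'n"
  assumes M: "M > 0" and y0: "y0 \<noteq> 0" and u: "TP_admissible A B M y0 u"
  shows "(M, y0) \<in> D_bbp A B"
proof -
  obtain t where t: "t > 0" "u \<in> bounded_controls M" "vanishes_at {0..} A B y0 u t"
    using u by (auto simp: TP_admissible_def)
  obtain v where v: "v \<in> bounded_measurable M" "y0 + moment A B t v = 0"
    using bounded_controls_representative[OF t(2) _ _ t(3)] M t(1) by auto
  define w where "w = (\<lambda>s. if s \<in> {0..t} then v s else 0)"
  have w: "w \<in> bounded_measurable M"
    unfolding w_def by (rule bounded_measurable_restrict[OF v(1)]) simp
  have "moment A B (t + 1) w = moment A B t w"
    by (rule moment_extend[OF w]) (use t(1) in \<open>auto simp: w_def\<close>)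
  also have "\<dots> = moment A B t v" unfolding w_def by (rule moment_restrict)
  finally have "y0 + moment A B (t + 1) w = 0" using v(2) by simp
  moreover have "\<not> (AE s in lebesgue_on {0<..<t+1}. norm (w s) = M)"
  proof
    assume "AE s in lebesgue_on {0<..<t+1}. norm (w s) = M"
    then have "negligible {s \<in> {0<..<t+1}. norm (w s) \<noteq> M}"
      by (simp add: AE_lebesgue_on_iff_negligible)
    \<comment> \<open>After \<open>t\<close> the control \<open>w\<close> is zero while
      \<open>M\<close> is positive, so this whole interval would lie in the null set.\<close>
    then have "negligible (box t (t + 1))"
      by (rule negligible_subset) (use t(1) M in \<open>auto simp: w_def\<close>)
    then show False by (simp add: negligible_iff_measure0)
  qed
  ultimately obtain M' where M': "M' < M" "feasible A B M' (t + 1) y0"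
    using smaller_control[OF w _ M] by blast
  have "(INF T\<in>{0<..}. min_norm A B T y0) \<le> min_norm A B (t + 1) y0"
    using t(1) by (intro INF_lower) auto
  also have "\<dots> \<le> ereal M'" using min_norm_le[OF _ M'(2)] t(1) by simp
  also have "\<dots> < ereal M" using M'(1) by simp
  finally show ?thesis
    using M y0 feasible_imp_ctrl_space[OF M'(2)] by (simp add: D_bbp_def Lim_min_norm)
qed

theorem proposition8p1:
  fixes A :: "real ^ 'n ^ 'n" and B :: "real ^ 'm ^ 'n"
  assumes "B \<noteq> 0"
  shows "(\<forall>M y0.
            ((M, y0) \<in> D_bbp A B \<longrightarrow> TP_bang_bang A B M y0) \<and>
            ((M, y0) \<in> ({0<..} \<times> (UNIV - {0})) - D_bbp A B \<longrightarrow> \<not> (\<exists>u. TP_admissible A B M y0 u))) \<and>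
         (\<forall>T y0.
            (T > 0 \<and> y0 \<in> ctrl_space A B - {0} \<longrightarrow> NP_bang_bang A B T y0) \<and>
            (T > 0 \<and> y0 \<in> UNIV - ctrl_space A B \<longrightarrow> \<not> (\<exists>v. NP_admissible A B T y0 v)))"
  by (auto intro: TP_bang_bang_D_bbp NP_bang_bang_ctrl_space
      dest: TP_admissible_imp_D_bbp NP_admissible_imp_ctrl_space)

end
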